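(* Let $V$ be a finite-dimensional real normed space with $\ell_\infty$-decomposition $V=(U\oplus\ell_\infty^d)_\infty$, and let $f\colon V\to V$ be a step-isometry. Then $f$ factorises over the decomposition as $f=f_U\oplus f_{\ell_\infty^d}$, where $f_U$ is a bijective isometry of $U$ and $f_{\ell_\infty^d}$ is a step-isometry of $\ell_\infty^d$.
   Context: For a subset $A$ of a normed space, a step-isometry on $A$ is a bijective function $f\colon A\to A$ such that $\lfloor\|x-y\|\rfloor=\lfloor\|f(x)-f(y)\|\rfloor$ for all $x,y\in A$. No continuity or linearity is assumed. An isometry is any distance-preserving map (not necessarily linear). $\ell_\infty^d$ is $\mathbb{R}^d$ with the max norm. $\ell_\infty$-decomposition: every finite-dimensional normed space $V$ has a unique maximal subspace $W$ isometric to $\ell_\infty^d$ for some $d\ge 0$ such that there is a subspace $U$ with $V=U\oplus W$ and $\|u+w\|=\max(\|u\|,\|w\|)$ for all $u\in U$, $w\in W$. One writes $V=(U\oplus\ell_\infty^d)_\infty$, identifying $W$ with $\ell_\infty^d$. If $V=U\oplus W$ and $f\colon V\to V$, then $f$ factorises over the decomposition, written $f=f_U\oplus f_W$, if there exist $f_U\colon U\to U$ and $f_W\colon W\to W$ with $f(u+w)=f_U(u)+f_W(w)$ for all $u\in U$, $w\in W$. *)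

theory Defs
  imports "HOL-Analysis.Analysis"
begin

definition step_isometry_on :: "'a::real_normed_vector set \<Rightarrow> ('a \<Rightarrow> 'a) \<Rightarrow> bool" where
  "step_isometry_on A f \<longleftrightarrow>
     bij_betw f A A \<and> (\<forall>x\<in>A. \<forall>y\<in>A. \<lfloor>norm (x - y)\<rfloor> = \<lfloor>norm (f x - f y)\<rfloor>)"

definition distance_preserving_on :: "'a::metric_space set \<Rightarrow> ('a \<Rightarrow> 'a) \<Rightarrow> bool" where
  "distance_preserving_on A f \<longleftrightarrow> (\<forall>x\<in>A. \<forall>y\<in>A. dist (f x) (f y) = dist x y)"

definition finite_dimensional :: "'a::real_vector itself \<Rightarrow> bool" where
  "finite_dimensional _ \<longleftrightarrow> (\<exists>B::'a set. finite B \<and> span B = UNIV)"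

text \<open>The vectors of \<open>\<real>\<^sup>d\<close> are the sequences vanishing from index \<open>d\<close> on, so that \<open>d\<close> can be
  quantified over and may be \<open>0\<close>.\<close>

definition linf_space :: "nat \<Rightarrow> (nat \<Rightarrow> real) set" where
  "linf_space d = {x. \<forall>i\<ge>d. x i = 0}"

text \<open>Inserting \<open>0\<close> only matters for \<open>d = 0\<close>, where the norm has to be \<open>0\<close>.\<close>

definition linf_norm :: "nat \<Rightarrow> (nat \<Rightarrow> real) \<Rightarrow> real" where
  "linf_norm d x = Max (insert 0 ((\<lambda>i. \<bar>x i\<bar>) ` {..<d}))"

text \<open>As isometries are not required to be linear, neither is \<open>\<phi>\<close>.  By the Mazur--Ulam theorem
  this gives the same subspaces \<open>W\<close> as linear isometries would.\<close>

definition isometric_to_linf :: "'a::real_normed_vector set \<Rightarrow> nat \<Rightarrow> bool" where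
  "isometric_to_linf W d \<longleftrightarrow>
     (\<exists>\<phi>. bij_betw \<phi> W (linf_space d) \<and>
          (\<forall>x\<in>W. \<forall>y\<in>W. linf_norm d (\<lambda>i. \<phi> x i - \<phi> y i) = norm (x - y)))"

definition direct_sum_decomposition :: "'a::real_vector set \<Rightarrow> 'a set \<Rightarrow> bool" where
  "direct_sum_decomposition U W \<longleftrightarrow>
     subspace U \<and> subspace W \<and> U \<inter> W = {0} \<and> (\<forall>v. \<exists>u\<in>U. \<exists>w\<in>W. v = u + w)"

definition linf_splitting :: "'a::real_normed_vector set \<Rightarrow> 'a set \<Rightarrow> nat \<Rightarrow> bool" where
  "linf_splitting U W d \<longleftrightarrow>
     direct_sum_decomposition U W \<and> isometric_to_linf W d \<and>
     (\<forall>u\<in>U. \<forall>w\<in>W. norm (u + w) = max (norm u) (norm w))"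

definition linf_decomposition :: "'a::real_normed_vector set \<Rightarrow> 'a set \<Rightarrow> nat \<Rightarrow> bool" where
  "linf_decomposition U W d \<longleftrightarrow>
     linf_splitting U W d \<and>
     (\<forall>U' W' d'. linf_splitting U' W' d' \<and> W \<subseteq> W' \<longrightarrow> W' = W)"

definition factorises_as ::
    "('a::real_vector \<Rightarrow> 'a) \<Rightarrow> 'a set \<Rightarrow> 'a set \<Rightarrow> ('a \<Rightarrow> 'a) \<Rightarrow> ('a \<Rightarrow> 'a) \<Rightarrow> bool" where
  "factorises_as f U W f\<^sub>U f\<^sub>W \<longleftrightarrow>
     f\<^sub>U \<in> U \<rightarrow> U \<and> f\<^sub>W \<in> W \<rightarrow> W \<and> (\<forall>u\<in>U. \<forall>w\<in>W. f (u + w) = f\<^sub>U u + f\<^sub>W w)"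

end

theory Submission
  imports Defs
begin

text \<open>
  Call a linear functional \<open>\<phi>\<close> smooth if it is the derivative of the norm at a point of
  differentiability: there is a unit vector \<open>v\<close> with \<open>norm (n v + y) - n \<longlonglongrightarrow> \<phi> y\<close> for all \<open>y\<close>.
  In finite dimension the smooth functionals norm the space (\<open>smooth_functionals_norming\<close>).
  From a far away point \<open>x + n v\<close> the distance to \<open>y\<close> is \<open>n + \<phi> (x - y)\<close> up to an error tending to
  \<open>0\<close>.  A step-isometry \<open>f\<close> preserves the integer part of this distance, so it preserves \<open>\<phi>\<close> up to
  rounding.  Moving the base point \<open>x\<close> turns the rounding into monotonicity: for some
  linear \<open>\<psi>\<close>, \<open>\<psi> (f y)\<close> grows weakly with \<open>\<phi> y\<close> and stays within bounded distance of
  \<open>\<phi> y\<close> plus a constant (\<open>step_isometry_transports\<close>).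

  All these \<open>\<psi>\<close> are of the form \<open>\<phi> \<circ> inv T\<close> for one linear isometry \<open>T\<close>, the limit of
  \<open>f (n x) / n\<close>.  Replacing \<open>f\<close> by \<open>g = inv T \<circ> f\<close> one gets \<open>\<psi> = \<phi>\<close>
  (\<open>step_isometry_near_linear_isometry\<close>).

  Now the smooth functionals fall into two classes.  If \<open>\<phi>\<close> is a linear combination of smooth
  functionals other than \<open>\<phi>\<close> and \<open>- \<phi>\<close>, this relation is inherited by the monotone functions
  through which \<open>g\<close> acts on them.  It makes the one for \<open>\<phi>\<close> additive, and an additive monotone
  function close to the identity is a translation: \<open>\<phi> (g y) = \<phi> y + k\<close>
  (\<open>nonfree_functional_rigid\<close>).  If \<open>\<phi>\<close> is free of such relations, then a vector killed by all
  smooth functionals but \<open>\<phi>\<close> and \<open>- \<phi>\<close> spans a line that splits off as a max-norm factor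
  (\<open>linf_splitting_extend\<close>).  As the \<open>\<ell>\<^sub>\<infinity>\<close>-part \<open>W\<close> is maximal, the free functionals are exactly
  the coordinates of \<open>W\<close> and their negatives.  Hence \<open>U\<close> is the common kernel of the free smooth
  functionals and \<open>W\<close> that of the others.  Both are therefore preserved by \<open>T\<close>, and modulo \<open>W\<close>
  the map \<open>g\<close> is a translation.

  It remains to see that the \<open>i\<close>-th coordinate of \<open>g y\<close> on \<open>W\<close> is a function of the \<open>i\<close>-th coordinate
  of \<open>y\<close>, that is, that the monotone relation between the two has no jumps
  (\<open>coordinate_no_jumps\<close>).  Then \<open>g (u + w) = u + g w\<close>, from which the factorisation is read off.
\<close>

section \<open>Finite-dimensional normed spaces\<close>

lemma finite_dimensional_basis:
  assumes "finite_dimensional TYPE('v::real_normed_vector)"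
  obtains B :: "'v::real_normed_vector set" where "finite B" "independent B" "span B = UNIV"
proof -
  obtain B0 :: "'v set" where B0: "finite B0" "span B0 = UNIV"
    using assms unfolding finite_dimensional_def by blast
  obtain B where B: "B \<subseteq> B0" "independent B" "B0 \<subseteq> span B"
    using maximal_independent_subset by blast
  have "finite B" using B B0 finite_subset by blast
  moreover have "span B = UNIV"
    by (metis B(3) B0(2) span_minimal subspace_span top.extremum_uniqueI)
  ultimately show thesis using that B(2) by blast
qed

lemma finite_dimensional_vector_space_scaleR:
  assumes "finite_dimensional TYPE('v::real_normed_vector)"
  obtains B where "finite_dimensional_vector_space (scaleR :: real \<Rightarrow> 'v \<Rightarrow> 'v::real_normed_vector) B"
proof -
  obtain B :: "'v set" where B: "finite B" "independent B" "span B = UNIV"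
    by (rule finite_dimensional_basis[OF assms]) (rule that)
  have "finite_dimensional_vector_space (scaleR :: real \<Rightarrow> 'v \<Rightarrow> 'v) B"
    by unfold_locales (use B in \<open>auto simp: dependent_raw_def span_raw_def algebra_simps\<close>)
  then show thesis by (rule that)
qed

lemma finite_dimensional_subspace_eqI:
  fixes S S' :: "'v::real_normed_vector set"
  assumes fd: "finite_dimensional TYPE('v)"
    and S: "subspace S" "subspace S'" "S \<subseteq> S'" "dim S' \<le> dim S"
  shows "S = S'"
proof -
  obtain B where "finite_dimensional_vector_space (scaleR :: real \<Rightarrow> 'v \<Rightarrow> 'v) B"
    using finite_dimensional_vector_space_scaleR[OF fd] by blast
  from finite_dimensional_vector_space.subspace_dim_equal[OF this] show ?thesis
    using S unfolding subspace_raw_def dim_raw_def by blast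
qed

lemma finite_dimensional_inj_imp_surj:
  fixes h :: "'v::real_normed_vector \<Rightarrow> 'v"
  assumes fd: "finite_dimensional TYPE('v)" and h: "linear h" "inj h"
  shows "surj h"
proof -
  obtain B where "finite_dimensional_vector_space (scaleR :: real \<Rightarrow> 'v \<Rightarrow> 'v) B"
    using finite_dimensional_vector_space_scaleR[OF fd] by blast
  from finite_dimensional_vector_space.linear_inj_imp_surj[OF this] show ?thesis
    using h unfolding linear_def by blast
qed

text \<open>The coordinates with respect to a basis are bounded because the coordinate vectors in the unit
  cube with some coordinate equal to \<open>1\<close> in absolute value form a compact set, on whose image the
  norm has a positive minimum.  The compact images of cubes are what compactness of balls is
  derived from.\<close>

lemma finite_dimensional_coordinates:
  assumes "finite_dimensional TYPE('v::real_normed_vector)"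
  obtains B :: "'v::real_normed_vector set" and r :: "'v \<Rightarrow> 'v::real_normed_vector \<Rightarrow> real"
  where "finite B" "\<And>b. b \<in> B \<Longrightarrow> bounded_linear (r b)" "\<And>x. x = (\<Sum>b\<in>B. r b x *\<^sub>R b)"
    "\<And>R. compact ((\<lambda>c. \<Sum>b\<in>B. c b *\<^sub>R b) ` (Pi\<^sub>E UNIV (\<lambda>b. if b \<in> B then {-R..R} else {0::real})))"
proof -
  obtain B :: "'v set" where finB: "finite B" and B: "independent B" and spanB: "span B = UNIV"
    by (rule finite_dimensional_basis[OF assms]) (rule that)
  define r where "r = (\<lambda>b x. representation B x b)"
  have lin: "linear (r b)" for b
  proof (rule linearI)
    fix x y :: 'v and c :: real
    show "r b (x + y) = r b x + r b y"
      unfolding r_def using representation_add[OF B] spanB by simp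
    show "r b (c *\<^sub>R x) = c *\<^sub>R r b x"
      unfolding r_def using representation_scale[OF B] spanB by simp
  qed
  have expand: "x = (\<Sum>b\<in>B. r b x *\<^sub>R b)" for x
    unfolding r_def using sum_representation_eq[OF B _ finB order_refl] spanB by simp
  have r_sum: "r b (\<Sum>b\<in>B. c b *\<^sub>R b) = c b" if "b \<in> B" for b c
  proof -
    have "r b (\<Sum>b'\<in>B. c b' *\<^sub>R b') = (\<Sum>b'\<in>B. c b' * r b b')"
      using lin by (simp add: linear_sum linear_cmul)
    also have "\<dots> = (\<Sum>b'\<in>B. if b' = b then c b else 0)"
      by (rule sum.cong) (auto simp: r_def representation_basis[OF B])
    also have "\<dots> = c b" using finB that by simp
    finally show ?thesis .
  qed
  define S where "S = (\<lambda>c. \<Sum>b\<in>B. c b *\<^sub>R b)"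
  define K where "K = (\<lambda>R. Pi\<^sub>E UNIV (\<lambda>b. if b \<in> B then {-R..R} else {0::real}))"
  have cont: "continuous_on A S" for A
    unfolding S_def by (intro continuous_intros continuous_on_product_then_coordinatewise continuous_on_id)
  have compK: "compact (K R)" for R
  proof -
    have "compactin (product_topology (\<lambda>_::'v. euclideanreal) UNIV) (K R)"
      unfolding K_def compactin_PiE by auto
    then show ?thesis unfolding euclidean_product_topology compactin_euclidean_iff .
  qed
  have comp: "compact (S ` K R)" for R
    by (rule compact_continuous_image[OF cont compK])
  have "\<exists>C>0. \<forall>x. \<bar>r b0 x\<bar> \<le> C * norm x" if b0: "b0 \<in> B" for b0
  proof -
    \<comment> \<open>Bounds the norm below where the coordinate at \<open>b\<close> has the largest absolute value, \<open>1\<close>; any other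
      vector is compared after dividing it by its largest coordinate.\<close>
    have *: "\<exists>m>0. \<forall>c\<in>K 1. \<bar>c b\<bar> = 1 \<longrightarrow> m \<le> norm (S c)" if b: "b \<in> B" for b
    proof -
      define L where "L = K 1 \<inter> {c. \<bar>c b\<bar> = 1}"
      have "closed {c::'v \<Rightarrow> real. \<bar>c b\<bar> = 1}"
        by (intro closed_Collect_eq continuous_intros continuous_on_product_then_coordinatewise
             continuous_on_id)
      then have cL: "compact L" unfolding L_def using compK compact_Int_closed by blast
      have neL: "(\<lambda>b'. if b' = b then 1 else 0) \<in> L" using b by (auto simp: L_def K_def PiE_def Pi_def)
      have "continuous_on L (\<lambda>c. norm (S c))" by (intro continuous_intros cont)
      then obtain c0 where c0: "c0 \<in> L" "\<And>c. c \<in> L \<Longrightarrow> norm (S c0) \<le> norm (S c)"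
        using continuous_attains_inf[OF cL] neL by blast
      have "S c0 \<noteq> 0"
      proof
        assume "S c0 = 0"
        then have "c0 b = 0" using r_sum[OF b, of c0] lin[of b] by (simp add: linear_0 S_def)
        then show False using c0(1) by (simp add: L_def)
      qed
      then show ?thesis using c0 by (intro exI[of _ "norm (S c0)"]) (auto simp: L_def)
    qed
    then obtain m where m: "\<And>b. b \<in> B \<Longrightarrow> m b > 0"
      "\<And>b c. b \<in> B \<Longrightarrow> c \<in> K 1 \<Longrightarrow> \<bar>c b\<bar> = 1 \<Longrightarrow> m b \<le> norm (S c)"
      by metis
    define M where "M = Min (m ` B)"
    have M: "M > 0" unfolding M_def using m(1) finB b0 by (subst Min_gr_iff) auto
    have bd: "M * \<bar>r b0 x\<bar> \<le> norm x" for x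
    proof -
      define s where "s = Max ((\<lambda>b. \<bar>r b x\<bar>) ` B)"
      have s_ge: "\<bar>r b x\<bar> \<le> s" if "b \<in> B" for b unfolding s_def using finB that by simp
      have "s \<in> (\<lambda>b. \<bar>r b x\<bar>) ` B"
        unfolding s_def using finB b0 by (intro Max_in) auto
      then obtain b1 where b1: "b1 \<in> B" "\<bar>r b1 x\<bar> = s" by auto
      show ?thesis
      proof (cases "s = 0")
        case True
        then show ?thesis using s_ge[OF b0] by simp
      next
        case False
        then have s: "s > 0" using s_ge[OF b0] by linarith
        define c where "c = (\<lambda>b. if b \<in> B then r b x / s else 0)"
        have c_le: "\<bar>r b x / s\<bar> \<le> 1" if "b \<in> B" for b using s_ge[OF that] s by simp
        have "c \<in> K 1"
          unfolding c_def K_def PiE_def Pi_def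
          using c_le by (fastforce simp: abs_le_iff simp del: abs_divide)
        moreover have "\<bar>c b1\<bar> = 1" using b1 s by (simp add: c_def)
        ultimately have "m b1 \<le> norm (S c)" using m b1 by blast
        also have "S c = (1 / s) *\<^sub>R x"
        proof -
          have "S c = (\<Sum>b\<in>B. (1 / s) *\<^sub>R (r b x *\<^sub>R b))" by (simp add: c_def S_def)
          also have "\<dots> = (1 / s) *\<^sub>R (\<Sum>b\<in>B. r b x *\<^sub>R b)" by (rule scaleR_sum_right[symmetric])
          also have "\<dots> = (1 / s) *\<^sub>R x" by (rule arg_cong[OF expand[symmetric]])
          finally show ?thesis .
        qed
        finally have "m b1 * s \<le> norm x" using s by (simp add: field_simps)
        moreover have "M \<le> m b1" unfolding M_def using finB b1 by simp
        ultimately have "M * s \<le> norm x" using s by (smt (verit) mult_right_mono)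
        then show ?thesis using s_ge[OF b0] M by (smt (verit) mult_left_mono)
      qed
    qed
    show ?thesis using bd M by (intro exI[of _ "1 / M"]) (simp add: field_simps)
  qed
  then have "bounded_linear (r b)" if "b \<in> B" for b
    using that lin[of b] by (metis bounded_linear_def bounded_linear_axioms_def real_norm_def mult.commute)
  with that[OF finB _ expand] comp show thesis unfolding S_def K_def by blast
qed

lemma compact_cball_finite_dimensional:
  fixes a :: "'v::real_normed_vector"
  assumes "finite_dimensional TYPE('v)"
  shows "compact (cball a R)"
proof -
  obtain B :: "'v set" and r where B: "finite B" "\<And>b. b \<in> B \<Longrightarrow> bounded_linear (r b)"
    "\<And>x. x = (\<Sum>b\<in>B. r b x *\<^sub>R b)"
    and comp: "\<And>R. compact ((\<lambda>c. \<Sum>b\<in>B. c b *\<^sub>R b) ` (Pi\<^sub>E UNIV (\<lambda>b. if b \<in> B then {-R..R} else {0::real})))"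
    by (rule finite_dimensional_coordinates[OF assms]) (rule that)
  obtain K where K: "\<And>b x. b \<in> B \<Longrightarrow> \<bar>r b x\<bar> \<le> norm x * K b" 
  proof -
    have "\<forall>b. \<exists>K. b \<in> B \<longrightarrow> (\<forall>x. \<bar>r b x\<bar> \<le> norm x * K)"
      using bounded_linear.bounded[OF B(2)] by fastforce
    then show thesis using that by metis
  qed
  define R' where "R' = (\<Sum>b\<in>B. (norm a + \<bar>R\<bar>) * \<bar>K b\<bar>)"
  have "cball a R \<subseteq> (\<lambda>c. \<Sum>b\<in>B. c b *\<^sub>R b) ` (Pi\<^sub>E UNIV (\<lambda>b. if b \<in> B then {-R'..R'} else {0::real}))"
  proof
    fix x assume "x \<in> cball a R"
    then have "norm (a - x) \<le> R" by (simp add: dist_norm)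
    then have nx: "norm x \<le> norm a + \<bar>R\<bar>"
      by (smt (verit) norm_triangle_ineq2 norm_minus_commute)
    have bd: "\<bar>r b x\<bar> \<le> R'" if b: "b \<in> B" for b
    proof -
      have "\<bar>r b x\<bar> \<le> norm x * \<bar>K b\<bar>" using K[OF b, of x] by (smt (verit) mult_left_mono norm_ge_zero)
      also have "\<dots> \<le> (norm a + \<bar>R\<bar>) * \<bar>K b\<bar>" using nx by (simp add: mult_right_mono)
      also have "\<dots> \<le> R'" unfolding R'_def
        by (rule member_le_sum[OF b _ B(1)]) simp
      finally show ?thesis .
    qed
    have "x = (\<Sum>b\<in>B. (if b \<in> B then r b x else 0) *\<^sub>R b)"
      by (rule trans[OF B(3)]) (rule sum.cong, simp_all)
    moreover have "(\<lambda>b. if b \<in> B then r b x else 0) \<in> Pi\<^sub>E UNIV (\<lambda>b. if b \<in> B then {-R'..R'} else {0::real})"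
      using bd by (fastforce simp: PiE_def Pi_def abs_le_iff)
    ultimately show "x \<in> (\<lambda>c. \<Sum>b\<in>B. c b *\<^sub>R b) ` (Pi\<^sub>E UNIV (\<lambda>b. if b \<in> B then {-R'..R'} else {0::real}))"
      by (rule image_eqI)
  qed
  then have "cball a R \<inter> (\<lambda>c. \<Sum>b\<in>B. c b *\<^sub>R b) ` (Pi\<^sub>E UNIV (\<lambda>b. if b \<in> B then {-R'..R'} else {0::real})) = cball a R"
    by (rule Int_absorb2)
  then show ?thesis using closed_Int_compact[OF closed_cball comp, of a R R'] by (simp only:)
qed

section \<open>Derivatives of the norm\<close>

text \<open>The limit along the integers alone is enough, as \<open>norm (t v + y) - t\<close> is monotone in \<open>t\<close>.  Up to the
  substitution \<open>t \<mapsto> 1 / t\<close> it is the difference quotient of the norm at \<open>v\<close> in the direction \<open>y\<close>;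
  the formulation used here is the one in which the distance from far away points appears.\<close>

definition norm_gradient :: "'v::real_normed_vector \<Rightarrow> ('v \<Rightarrow> real) \<Rightarrow> bool" where
  "norm_gradient v \<phi> \<longleftrightarrow> norm v = 1 \<and> linear \<phi> \<and>
     (\<forall>y. (\<lambda>n. norm (real n *\<^sub>R v + y) - real n) \<longlonglongrightarrow> \<phi> y)"

definition smooth_functional :: "('v::real_normed_vector \<Rightarrow> real) \<Rightarrow> bool" where
  "smooth_functional \<phi> \<longleftrightarrow> (\<exists>v. norm_gradient v \<phi>)"

lemma norm_gradientD:
  assumes "norm_gradient v \<phi>"
  shows "norm v = 1" "linear \<phi>" "(\<lambda>n. norm (real n *\<^sub>R v + y) - real n) \<longlonglongrightarrow> \<phi> y"
  using assms by (simp_all add: norm_gradient_def)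

lemma norm_gradient_self:
  assumes "norm_gradient v \<phi>"
  shows "\<phi> v = 1"
proof -
  have "norm (real n *\<^sub>R v + v) - real n = 1" for n
  proof -
    have "real n *\<^sub>R v + v = (real n + 1) *\<^sub>R v" by (simp add: algebra_simps)
    then show ?thesis using norm_gradientD(1)[OF assms] by simp
  qed
  then show ?thesis using norm_gradientD(3)[OF assms, of v] by (simp add: LIMSEQ_const_iff)
qed

lemma norm_gradient_le_norm:
  assumes "norm_gradient v \<phi>"
  shows "\<phi> y \<le> norm y"
proof -
  have "norm (real n *\<^sub>R v + y) - real n \<le> norm y" for n
    using norm_triangle_ineq[of "real n *\<^sub>R v" y] norm_gradientD(1)[OF assms] by simp
  then show ?thesis using LIMSEQ_le_const2[OF norm_gradientD(3)[OF assms]] by blast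
qed

lemma norm_gradient_uminus:
  assumes "norm_gradient v \<phi>"
  shows "norm_gradient (- v) (\<lambda>x. - \<phi> x)"
proof -
  have "norm (real n *\<^sub>R (- v) + y) = norm (real n *\<^sub>R v + (- y))" for n y
    using norm_minus_cancel[of "real n *\<^sub>R v + (- y)"] by (simp add: algebra_simps)
  then have "(\<lambda>n. norm (real n *\<^sub>R (- v) + y) - real n) \<longlonglongrightarrow> - \<phi> y" for y
    using norm_gradientD(3)[OF assms, of "- y"] linear_neg[OF norm_gradientD(2)[OF assms], of y] by simp
  moreover have "linear (\<lambda>x. - \<phi> x)" using norm_gradientD(2)[OF assms] by (rule linear_compose_neg)
  ultimately show ?thesis using norm_gradientD(1)[OF assms] unfolding norm_gradient_def by simp
qed

lemma smooth_functional_linear: "smooth_functional \<phi> \<Longrightarrow> linear \<phi>"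
  by (auto simp: smooth_functional_def norm_gradient_def)

lemma smooth_functional_le_norm: "smooth_functional \<phi> \<Longrightarrow> \<phi> y \<le> norm y"
  by (auto simp: smooth_functional_def norm_gradient_le_norm)

lemma smooth_functional_uminus: "smooth_functional \<phi> \<Longrightarrow> smooth_functional (\<lambda>x. - \<phi> x)"
  using norm_gradient_uminus unfolding smooth_functional_def by blast

lemma smooth_functional_abs_le_norm:
  assumes "smooth_functional \<phi>"
  shows "\<bar>\<phi> y\<bar> \<le> norm y"
  using smooth_functional_le_norm[OF assms, of y]
    smooth_functional_le_norm[OF smooth_functional_uminus[OF assms], of y] by simp

text \<open>Points of differentiability of the norm are dense.  To find one near \<open>x\<close>, maximise
  \<open>norm z - C Q (z - x)\<close> for a positive definite quadratic form \<open>Q\<close> and a large constant \<open>C\<close>.  At a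
  maximum \<open>z\<close> the norm lies below a quadratic function touching it at \<open>z\<close>, so by convexity it is
  differentiable there.  The maximum is close to \<open>x\<close> because the norm is Lipschitz while the
  penalty is quadratic.\<close>

lemma smooth_functionals_norming:
  fixes x :: "'v::real_normed_vector"
  assumes fd: "finite_dimensional TYPE('v)" and x: "x \<noteq> 0" and e: "e > 0"
  shows "\<exists>\<phi>. smooth_functional \<phi> \<and> norm x - e < \<phi> x"
proof -
  obtain B :: "'v set" and r where B: "finite B" "\<And>b. b \<in> B \<Longrightarrow> bounded_linear (r b)"
    "\<And>x. x = (\<Sum>b\<in>B. r b x *\<^sub>R b)"
    by (rule finite_dimensional_coordinates[OF fd]) (rule that)
  define Q where "Q = (\<lambda>y. \<Sum>b\<in>B. (r b y)\<^sup>2)"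
  define P where "P = (\<lambda>a y. \<Sum>b\<in>B. r b a * r b y)"
  have rlin: "b \<in> B \<Longrightarrow> linear (r b)" for b using B(2) bounded_linear.linear by blast
  have Q_add: "Q (a + y) = Q a + 2 * P a y + Q y" for a y
    unfolding Q_def P_def sum_distrib_left sum.distrib[symmetric]
    by (rule sum.cong) (simp_all add: linear_add[OF rlin] power2_eq_square algebra_simps)
  have P_lin: "linear (P a)" for a
    unfolding P_def
    by (rule linearI) (simp_all add: sum.distrib[symmetric] sum_distrib_left linear_add[OF rlin]
        linear_scale[OF rlin] algebra_simps cong: sum.cong)
  have Q_scale: "Q (c *\<^sub>R y) = c\<^sup>2 * Q y" for c y
    unfolding Q_def sum_distrib_left
    by (rule sum.cong) (simp_all add: linear_scale[OF rlin] power_mult_distrib)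
  have Q_uminus: "Q (- y) = Q y" for y using Q_scale[of "-1" y] by simp
  define D where "D = (\<Sum>b\<in>B. (norm b)\<^sup>2) + 1"
  have D: "D > 0" unfolding D_def using sum_nonneg[of B "\<lambda>b. (norm b)\<^sup>2"] by simp
  have Q_ge: "(norm y)\<^sup>2 \<le> D * Q y" for y
  proof -
    have "norm y \<le> (\<Sum>b\<in>B. \<bar>r b y\<bar> * norm b)"
    proof -
      have "norm (\<Sum>b\<in>B. r b y *\<^sub>R b) \<le> (\<Sum>b\<in>B. \<bar>r b y\<bar> * norm b)"
        by (rule sum_norm_le) simp
      then show ?thesis using B(3)[of y] by (rule ssubst[rotated])
    qed
    then have "(norm y)\<^sup>2 \<le> (\<Sum>b\<in>B. \<bar>r b y\<bar> * norm b)\<^sup>2" by (rule power_mono) simp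
    also have "\<dots> \<le> (\<Sum>b\<in>B. \<bar>r b y\<bar>\<^sup>2) * (\<Sum>b\<in>B. (norm b)\<^sup>2)"
      by (rule Cauchy_Schwarz_ineq_sum)
    also have "\<dots> = (D - 1) * Q y" unfolding Q_def D_def by simp
    also have "\<dots> \<le> D * Q y" 
      unfolding Q_def by (intro mult_right_mono sum_nonneg) simp_all
    finally show ?thesis .
  qed
  \<comment> \<open>The maximum will be at distance at most \<open>1 / k\<close> from \<open>x\<close>: within the ball where it is sought, close
    enough for the error \<open>e\<close>, and away from \<open>0\<close>.\<close>
  define k where "k = max 1 (max (3 / e) (2 / norm x))"
  have k: "k \<ge> 1" "3 / e \<le> k" "2 / norm x \<le> k" unfolding k_def by auto
  define C where "C = D * k"
  have C: "C > 0" using D k unfolding C_def by simp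
  have CQ: "k * (norm y)\<^sup>2 \<le> C * Q y" for y
    using mult_left_mono[OF Q_ge[of y], of k] k(1) unfolding C_def by (simp add: algebra_simps)
  define g where "g = (\<lambda>z. norm z - C * Q (z - x))"
  have "continuous_on (cball x 1) g"
    unfolding g_def Q_def
    by (intro continuous_intros bounded_linear.continuous_on[OF B(2)])
  then obtain z where z: "z \<in> cball x 1" "\<And>y. y \<in> cball x 1 \<Longrightarrow> g y \<le> g z"
    using continuous_attains_sup[OF compact_cball_finite_dimensional[OF fd]] 
    by (metis cball_eq_empty not_one_less_zero)
  have Q0: "Q 0 = 0" using Q_scale[of 0 0] by simp
  have gx: "g x = norm x" unfolding g_def by (simp add: Q0)
  have g_le: "g y \<le> norm x + norm (y - x) - k * (norm (y - x))\<^sup>2" for y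
    using CQ[of "y - x"] norm_triangle_ineq[of x "y - x"] unfolding g_def by simp
  have max: "g y \<le> g z" for y
  proof (cases "y \<in> cball x 1")
    case False
    then have n: "norm (y - x) > 1" by (simp add: dist_norm norm_minus_commute)
    then have "norm (y - x) * 1 \<le> norm (y - x) * norm (y - x)" by (intro mult_left_mono) simp_all
    also have "\<dots> \<le> k * (norm (y - x) * norm (y - x))"
      using k(1) mult_right_mono[of 1 k "norm (y - x) * norm (y - x)"] by simp
    finally have "g y \<le> norm x" using g_le[of y] by (simp add: power2_eq_square)
    also have "\<dots> \<le> g z" using z(2)[of x] gx by simp
    finally show ?thesis .
  qed (use z in simp)
  have zx: "k * norm (z - x) \<le> 1"
  proof (cases "z = x")
    case False
    have "norm x \<le> g z" using max[of x] gx by simp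
    then have "k * norm (z - x) * norm (z - x) \<le> 1 * norm (z - x)"
      using g_le[of z] by (simp add: power2_eq_square)
    then show ?thesis by (rule mult_right_le_imp_le) (use False in simp)
  qed simp
  have zx1: "3 * norm (z - x) \<le> e"
  proof -
    have "3 / e * norm (z - x) \<le> 1" using zx k(2) by (smt (verit) mult_right_mono norm_ge_zero)
    then show ?thesis using e by (simp add: field_simps)
  qed
  have zx2: "2 * norm (z - x) \<le> norm x"
  proof -
    have "2 / norm x * norm (z - x) \<le> 1" using zx k(3) by (smt (verit) mult_right_mono norm_ge_zero)
    then show ?thesis using x by (simp add: field_simps)
  qed
  have z0: "z \<noteq> 0" using zx2 x by auto
  define l where "l = (\<lambda>y. 2 * C * P (z - x) y)"
  have l_lin: "linear l" unfolding l_def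
    using linear_compose_scale_right[OF P_lin, of "2 * C"] by simp
  have up: "norm (z + y) \<le> norm z + l y + C * Q y" for y
  proof -
    have "norm (z + y) - C * Q ((z - x) + y) \<le> norm z - C * Q (z - x)"
      using max[of "z + y"] unfolding g_def by (simp add: algebra_simps)
    then show ?thesis unfolding Q_add l_def by (simp add: algebra_simps)
  qed
  \<comment> \<open>Convexity along the segment from \<open>z - y\<close> to \<open>z + y\<close> turns the upper bound into a lower one.\<close>
  have lo: "norm z + l y - C * Q y \<le> norm (z + y)" for y
  proof -
    have "2 * norm z \<le> norm (z + y) + norm (z - y)"
      using norm_triangle_ineq[of "z + y" "z - y"] by (simp flip: scaleR_2)
    moreover have "norm (z - y) \<le> norm z - l y + C * Q y"
      using up[of "- y"] linear_neg[OF l_lin, of y] Q_uminus[of y] by simp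
    ultimately show ?thesis by linarith
  qed
  define v where "v = (1 / norm z) *\<^sub>R z"
  have "(\<lambda>n. norm (real n *\<^sub>R v + y) - real n) \<longlonglongrightarrow> l y" for y
  proof -
    define E where "E = C * norm z * Q y"
    have bd: "\<bar>norm (real n *\<^sub>R v + y) - real n - l y\<bar> \<le> E / real n" if n: "n > 0" for n
    proof -
      define s where "s = norm z / real n"
      have s: "s > 0" unfolding s_def using n z0 by simp
      have "real n *\<^sub>R v + y = (1 / s) *\<^sub>R (z + s *\<^sub>R y)"
        unfolding v_def s_def using n z0 by (simp add: algebra_simps)
      then have nn: "norm (real n *\<^sub>R v + y) = (1 / s) * norm (z + s *\<^sub>R y)"
        using s by simp
      have rn: "real n = (1 / s) * norm z" unfolding s_def using n z0 by simp
      have "\<bar>norm (z + s *\<^sub>R y) - norm z - s * l y\<bar> \<le> C * (s\<^sup>2 * Q y)"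
        using up[of "s *\<^sub>R y"] lo[of "s *\<^sub>R y"] linear_scale[OF l_lin, of s y] Q_scale[of s y] 
        by (simp add: abs_le_iff)
      then have "(1 / s) * \<bar>norm (z + s *\<^sub>R y) - norm z - s * l y\<bar> \<le> (1 / s) * (C * (s\<^sup>2 * Q y))"
        using s by (intro mult_left_mono) simp_all
      also have "(1 / s) * (C * (s\<^sup>2 * Q y)) = E / real n"
        unfolding E_def s_def using n z0 by (simp add: field_simps power2_eq_square)
      also have "(1 / s) * \<bar>norm (z + s *\<^sub>R y) - norm z - s * l y\<bar>
          = \<bar>(1 / s) * (norm (z + s *\<^sub>R y) - norm z - s * l y)\<bar>"
        using s by (simp add: abs_mult)
      also have "(1 / s) * (norm (z + s *\<^sub>R y) - norm z - s * l y) = norm (real n *\<^sub>R v + y) - real n - l y"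
        unfolding nn using rn s by (simp add: field_simps)
      finally show ?thesis .
    qed
    have "(\<lambda>n. E / real n) \<longlonglongrightarrow> 0" by (rule lim_const_over_n)
    then have "(\<lambda>n. norm (real n *\<^sub>R v + y) - real n - l y) \<longlonglongrightarrow> 0"
      by (rule Lim_null_comparison[rotated])
        (use bd in \<open>auto simp: eventually_sequentially intro!: exI[of _ 1]\<close>)
    then show ?thesis by (simp add: LIM_zero_iff)
  qed
  moreover have "norm v = 1" unfolding v_def using z0 by simp
  ultimately have ng: "norm_gradient v l" unfolding norm_gradient_def using l_lin by blast
  then have sm: "smooth_functional l" unfolding smooth_functional_def by blast
  have "l v = 1" by (rule norm_gradient_self[OF ng])
  then have "l z = norm z" unfolding v_def using linear_scale[OF l_lin, of "1 / norm z" z] z0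
    by (simp add: field_simps)
  then have "norm x - e < l x"
    using smooth_functional_le_norm[OF sm, of "z - x"] linear_diff[OF l_lin, of z x] zx1 e
      norm_triangle_ineq2[of x z] norm_minus_commute[of x z] norm_ge_zero[of "z - x"] by linarith
  then show ?thesis using sm by blast
qed

lemma norm_le_if_smooth_functionals_le:
  fixes x :: "'v::real_normed_vector"
  assumes "finite_dimensional TYPE('v)" "0 \<le> c" "\<And>\<phi>. smooth_functional \<phi> \<Longrightarrow> \<phi> x \<le> c"
  shows "norm x \<le> c"
proof (cases "x = 0")
  case False
  show ?thesis
  proof (rule field_le_epsilon)
    fix e :: real assume "e > 0"
    then show "norm x \<le> c + e" using smooth_functionals_norming[OF assms(1) False] assms(3) 
      by (smt (verit))
  qed
qed (use assms in simp)

lemma eq_0_if_smooth_functionals_eq_0: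
  fixes x :: "'v::real_normed_vector"
  assumes "finite_dimensional TYPE('v)" "\<And>\<phi>. smooth_functional \<phi> \<Longrightarrow> \<phi> x = 0"
  shows "x = 0"
proof -
  have "norm x \<le> 0" by (rule norm_le_if_smooth_functionals_le) (simp_all add: assms)
  then show ?thesis by simp
qed

section \<open>Convex functions that are forced to be affine\<close>

lemma linear_if_affine:
  fixes F :: "'v::real_vector \<Rightarrow> real"
  assumes "\<And>t x y. 0 \<le> t \<Longrightarrow> t \<le> 1 \<Longrightarrow> F ((1 - t) *\<^sub>R x + t *\<^sub>R y) = (1 - t) * F x + t * F y"
  shows "linear (\<lambda>x. F x - F 0)"
proof -
  define G where "G = (\<lambda>x. F x - F 0)"
  have G0: "G 0 = 0" by (simp add: G_def)
  have G: "G ((1 - t) *\<^sub>R x + t *\<^sub>R y) = (1 - t) * G x + t * G y" if "0 \<le> t" "t \<le> 1" for t x y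
    using assms[OF that, of x y] by (simp add: G_def algebra_simps)
  have small: "G (t *\<^sub>R y) = t * G y" if "0 \<le> t" "t \<le> 1" for t y
    using G[OF that, of 0 y] G0 by simp
  have pos: "G (t *\<^sub>R y) = t * G y" if "0 \<le> t" for t y
  proof (cases "t \<le> 1")
    case False
    then have "G ((1 / t) *\<^sub>R (t *\<^sub>R y)) = (1 / t) * G (t *\<^sub>R y)" by (intro small) auto
    then show ?thesis using False by (simp add: field_simps)
  qed (use small that in auto)
  have add: "G (x + y) = G x + G y" for x y
  proof -
    have "G (x + y) = 2 * G ((1 / 2) *\<^sub>R (x + y))" using pos[of "1/2" "x + y"] by simp
    also have "G ((1 / 2) *\<^sub>R (x + y)) = (G x + G y) / 2" 
      using G[of "1/2" x y] by (simp add: scaleR_add_right)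
    finally show ?thesis by simp
  qed
  have neg: "G (- y) = - G y" for y using add[of y "- y"] G0 by simp
  have "G (t *\<^sub>R y) = t * G y" for t y
  proof (cases "0 \<le> t")
    case False
    then show ?thesis using pos[of "- t" y] neg[of "t *\<^sub>R y"] by simp
  qed (use pos in auto)
  then have "linear G" using add by (intro linearI) auto
  then show ?thesis unfolding G_def .
qed

text \<open>A convex function bounded on the whole space cannot increase along any ray, since it would go on
  to increase linearly.\<close>

lemma convex_on_bounded_imp_le:
  fixes S :: "'v::real_vector \<Rightarrow> real"
  assumes S: "convex_on UNIV S" and C: "\<And>x. \<bar>S x\<bar> \<le> C"
  shows "S y \<le> S x"
proof (rule field_le_epsilon)
  fix e :: real assume e: "e > 0"
  define t where "t = min 1 (e / (2 * C + 1))"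
  have C0: "C \<ge> 0" using C[of x] by linarith
  have t: "0 < t" "t \<le> 1" "t * (2 * C + 1) \<le> e"
  proof -
    show "0 < t" "t \<le> 1" unfolding t_def using e C0 by auto
    have "t \<le> e / (2 * C + 1)" unfolding t_def by simp
    then show "t * (2 * C + 1) \<le> e" using C0 by (simp add: pos_le_divide_eq)
  qed
  define z where "z = x + (1 / t) *\<^sub>R (y - x)"
  have "y = (1 - t) *\<^sub>R x + t *\<^sub>R z" unfolding z_def using t by (simp add: algebra_simps)
  then have "S y \<le> (1 - t) * S x + t * S z" using convex_onD[OF S, of t x z] t by simp
  also have "\<dots> = S x + t * (S z - S x)" by (simp add: algebra_simps)
  also have "\<dots> \<le> S x + t * (2 * C + 1)" 
    using C[of x] C[of z] t by (intro add_left_mono mult_left_mono) auto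
  also have "\<dots> \<le> S x + e" using t by simp
  finally show "S y \<le> S x + e" .
qed

text \<open>The sum is convex and bounded, hence constant, so \<open>P\<close> is at the same time convex and concave.\<close>

lemma linear_if_convex_sum_bounded:
  fixes P Q :: "'v::real_vector \<Rightarrow> real"
  assumes P: "convex_on UNIV P" and Q: "convex_on UNIV Q" and C: "\<And>x. \<bar>P x + Q x\<bar> \<le> C"
  shows "linear (\<lambda>x. P x - P 0)"
proof (rule linear_if_affine)
  fix t :: real and x y :: 'v assume t: "0 \<le> t" "t \<le> 1"
  have S: "convex_on UNIV (\<lambda>x. P x + Q x)" using P Q by (rule convex_on_add)
  have const: "P a + Q a = P 0 + Q 0" for a
    using convex_on_bounded_imp_le[OF S C, of a 0] convex_on_bounded_imp_le[OF S C, of 0 a] by simp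
  let ?z = "(1 - t) *\<^sub>R x + t *\<^sub>R y"
  have "P ?z \<le> (1 - t) * P x + t * P y" using convex_onD[OF P] t by simp
  moreover have "Q ?z \<le> (1 - t) * Q x + t * Q y" using convex_onD[OF Q] t by simp
  moreover have "(1 - t) * Q x + t * Q y = P 0 + Q 0 - ((1 - t) * P x + t * P y)"
  proof -
    have "(1 - t) * (P x + Q x) + t * (P y + Q y) = P 0 + Q 0"
      by (simp only: const[of x] const[of y]) (simp add: algebra_simps)
    then show ?thesis by (simp add: algebra_simps)
  qed
  ultimately show "P ?z = (1 - t) * P x + t * P y" using const[of ?z] by linarith
qed

lemma linear_bounded_imp_0:
  fixes \<psi> :: "'v::real_vector \<Rightarrow> real"
  assumes "linear \<psi>" "\<And>y. \<bar>\<psi> y\<bar> \<le> C"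
  shows "\<psi> y = 0"
proof (rule ccontr)
  assume "\<psi> y \<noteq> 0"
  then have "\<psi> (((\<bar>C\<bar> + 1) / \<psi> y) *\<^sub>R y) = \<bar>C\<bar> + 1" using linear_scale[OF assms(1)] by simp
  then show False using assms(2)[of "((\<bar>C\<bar> + 1) / \<psi> y) *\<^sub>R y"] by simp
qed

section \<open>Step-isometries transport smooth functionals\<close>

text \<open>A real-valued limit superior.  Unlike a limit along a subsequence, it exists for all
  points simultaneously, and it preserves convexity.\<close>

definition upper_limit :: "(nat \<Rightarrow> real) \<Rightarrow> real" where
  "upper_limit X = Inf {c. \<forall>\<^sub>F n in sequentially. X n \<le> c}"

lemma upper_limit_bdd_below:
  assumes "\<forall>\<^sub>F n in sequentially. a \<le> X n"
  shows "\<And>c. \<forall>\<^sub>F n in sequentially. X n \<le> c \<Longrightarrow> a \<le> c"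
    "bdd_below {c. \<forall>\<^sub>F n in sequentially. X n \<le> (c::real)}"
proof -
  show *: "a \<le> c" if "\<forall>\<^sub>F n in sequentially. X n \<le> c" for c
  proof -
    have "\<forall>\<^sub>F n in sequentially. a \<le> c" using assms that by eventually_elim linarith
    then show ?thesis by simp
  qed
  then show "bdd_below {c. \<forall>\<^sub>F n in sequentially. X n \<le> (c::real)}" by (intro bdd_belowI[of _ a]) auto
qed

lemma upper_limit_le:
  assumes "\<forall>\<^sub>F n in sequentially. a \<le> X n" "\<forall>\<^sub>F n in sequentially. X n \<le> c"
  shows "upper_limit X \<le> c"
  unfolding upper_limit_def using upper_limit_bdd_below(2)[OF assms(1)] assms(2) 
  by (intro cInf_lower) auto

lemma upper_limit_ge:
  assumes "\<forall>\<^sub>F n in sequentially. a \<le> X n" "\<forall>\<^sub>F n in sequentially. X n \<le> c"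
  shows "a \<le> upper_limit X"
  unfolding upper_limit_def using upper_limit_bdd_below(1)[OF assms(1)] assms(2) 
  by (intro cInf_greatest) auto

lemma eventually_le_upper_limit:
  assumes "\<forall>\<^sub>F n in sequentially. X n \<le> c" "e > 0"
  shows "\<forall>\<^sub>F n in sequentially. X n \<le> upper_limit X + e"
proof -
  have "\<exists>c' \<in> {c. \<forall>\<^sub>F n in sequentially. X n \<le> c}. c' < upper_limit X + e"
    unfolding upper_limit_def using assms by (intro cInf_lessD) auto
  then obtain c' where "\<forall>\<^sub>F n in sequentially. X n \<le> c'" "c' < upper_limit X + e" by blast
  then show ?thesis by (elim eventually_mono) linarith
qed

lemma convex_on_upper_limit_dist:
  fixes p :: "nat \<Rightarrow> 'v::real_normed_vector"
  assumes lo: "\<And>w. \<exists>a. \<forall>\<^sub>F n in sequentially. a \<le> norm (p n - w) - real n"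
    and hi: "\<And>w. \<exists>b. \<forall>\<^sub>F n in sequentially. norm (p n - w) - real n \<le> b"
  shows "convex_on UNIV (\<lambda>w. upper_limit (\<lambda>n. norm (p n - w) - real n))"
proof (rule convex_onI)
  fix t :: real and x y :: 'v assume t: "0 < t" "t < 1"
  let ?X = "\<lambda>w n. norm (p n - w) - real n"
  let ?z = "(1 - t) *\<^sub>R x + t *\<^sub>R y"
  show "upper_limit (?X ?z) \<le> (1 - t) * upper_limit (?X x) + t * upper_limit (?X y)"
  proof (rule field_le_epsilon)
    fix e :: real assume e: "e > 0"
    have X: "?X ?z n \<le> (1 - t) * ?X x n + t * ?X y n" for n
    proof -
      have "p n - ?z = (1 - t) *\<^sub>R (p n - x) + t *\<^sub>R (p n - y)" by (simp add: algebra_simps)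
      then have "norm (p n - ?z) \<le> (1 - t) * norm (p n - x) + t * norm (p n - y)"
        using t norm_triangle_ineq[of "(1 - t) *\<^sub>R (p n - x)" "t *\<^sub>R (p n - y)"] by simp
      then show ?thesis by (simp add: algebra_simps)
    qed
    obtain a b c where abc: "\<forall>\<^sub>F n in sequentially. a \<le> ?X ?z n"
      "\<forall>\<^sub>F n in sequentially. ?X x n \<le> b" "\<forall>\<^sub>F n in sequentially. ?X y n \<le> c"
      using lo[of ?z] hi[of x] hi[of y] by blast
    have "\<forall>\<^sub>F n in sequentially. ?X ?z n \<le> (1 - t) * upper_limit (?X x) + t * upper_limit (?X y) + e"
      using eventually_le_upper_limit[OF abc(2) e] eventually_le_upper_limit[OF abc(3) e]
    proof eventually_elim
      case (elim n)
      have "(1 - t) * ?X x n + t * ?X y n \<le> (1 - t) * (upper_limit (?X x) + e) + t * (upper_limit (?X y) + e)"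
        using elim t by (intro add_mono mult_left_mono) auto
      then show ?case using X[of n] by (simp add: algebra_simps)
    qed
    then show "upper_limit (?X ?z) \<le> (1 - t) * upper_limit (?X x) + t * upper_limit (?X y) + e"
      by (rule upper_limit_le[OF abc(1)])
  qed
qed simp

text \<open>\<open>\<psi> (f y)\<close> is an increasing function of \<open>\<phi> y\<close>, except that at a jump of this function it may take
  several values.\<close>

definition transports :: "('v::real_normed_vector \<Rightarrow> 'v) \<Rightarrow> ('v \<Rightarrow> real) \<Rightarrow> ('v \<Rightarrow> real) \<Rightarrow> bool" where
  "transports f \<phi> \<psi> \<longleftrightarrow> linear \<psi> \<and>
     (\<forall>y y'. \<phi> y < \<phi> y' \<longrightarrow> \<psi> (f y) \<le> \<psi> (f y')) \<and> (\<exists>\<kappa>. \<forall>y. \<bar>\<psi> (f y) - \<phi> y - \<kappa>\<bar> \<le> 1)"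

text \<open>The convergence is from above, and the floor function is continuous from the right.\<close>

lemma eventually_floor_norm_gradient:
  assumes "norm_gradient v \<phi>"
  shows "\<forall>\<^sub>F n in sequentially. \<lfloor>norm (real n *\<^sub>R v + y) - real n\<rfloor> = \<lfloor>\<phi> y\<rfloor>"
proof -
  have "\<phi> y \<le> norm (real n *\<^sub>R v + y) - real n" for n
  proof -
    have "\<phi> (real n *\<^sub>R v + y) = real n + \<phi> y"
      using norm_gradientD(2)[OF assms] norm_gradient_self[OF assms]
      by (simp add: linear_add linear_scale)
    then show ?thesis using norm_gradient_le_norm[OF assms, of "real n *\<^sub>R v + y"] by simp
  qed
  moreover have "\<forall>\<^sub>F n in sequentially. norm (real n *\<^sub>R v + y) - real n < of_int \<lfloor>\<phi> y\<rfloor> + 1"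
    by (rule order_tendstoD(2)[OF norm_gradientD(3)[OF assms]]) simp
  ultimately show ?thesis
    by (auto elim!: eventually_mono simp: floor_eq_iff) (meson of_int_floor_le order_trans)
qed

lemma step_isometry_on_UNIV_D:
  assumes "step_isometry_on UNIV f"
  shows "bij f" "\<lfloor>norm (f x - f y)\<rfloor> = \<lfloor>norm (x - y)\<rfloor>"
  using assms unfolding step_isometry_on_def by auto

text \<open>For \<open>v\<close> with derivative \<open>\<phi>\<close> consider the function \<open>\<beta>\<close> that measures distances from the images of the
  points \<open>x + n v\<close>, normalised by subtracting \<open>n\<close>.  It is convex, and on the image of \<open>y\<close> it equals
  \<open>\<phi> (x - y)\<close> up to rounding.  The same construction with \<open>- v\<close> gives a convex function that is
  nearly \<open>- \<phi> (x - y)\<close>.  Their sum is bounded, so \<open>\<beta>\<close> is affine.  Its linear part does not depend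
  on \<open>x\<close>, and choosing \<open>x\<close> on the level of \<open>\<phi>\<close> that contains \<open>y\<close> separates the images of
  lower and higher levels.\<close>

lemma step_isometry_transports:
  fixes f :: "'v::real_normed_vector \<Rightarrow> 'v"
  assumes f: "step_isometry_on UNIV f" and "smooth_functional \<phi>"
  shows "\<exists>\<psi>. transports f \<phi> \<psi>"
proof -
  obtain v where v: "norm_gradient v \<phi>"
    using assms(2) unfolding smooth_functional_def by blast
  have lin: "linear \<phi>" by (rule norm_gradientD(2)[OF v])
  define \<beta> where "\<beta> = (\<lambda>v x w. upper_limit (\<lambda>n. norm (f (x + real n *\<^sub>R v) - w) - real n))"
  have ev: "\<forall>\<^sub>F n in sequentially. of_int \<lfloor>\<eta> (x - y)\<rfloor> \<le> norm (f (x + real n *\<^sub>R u) - f y) - real n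
      \<and> norm (f (x + real n *\<^sub>R u) - f y) - real n \<le> of_int \<lfloor>\<eta> (x - y)\<rfloor> + 1"
    if "norm_gradient u \<eta>" for u \<eta> x y
    using eventually_floor_norm_gradient[OF that, of "x - y"]
  proof eventually_elim
    case (elim n)
    have "\<lfloor>norm (f (x + real n *\<^sub>R u) - f y) - real n\<rfloor> = \<lfloor>norm (f (x + real n *\<^sub>R u) - f y)\<rfloor> - int n"
      by (metis floor_diff_of_int of_int_of_nat_eq)
    also have "\<dots> = \<lfloor>norm (real n *\<^sub>R u + (x - y))\<rfloor> - int n"
      using step_isometry_on_UNIV_D(2)[OF f, of "x + real n *\<^sub>R u" y] by (simp add: algebra_simps)
    also have "\<dots> = \<lfloor>norm (real n *\<^sub>R u + (x - y)) - real n\<rfloor>"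
      by (metis floor_diff_of_int of_int_of_nat_eq)
    finally show ?case using elim by linarith
  qed
  have surj: "\<exists>y. w = f y" for w
    using step_isometry_on_UNIV_D(1)[OF f] by (metis bij_pointE)
  have \<beta>_conv: "convex_on UNIV (\<beta> u x)" if "norm_gradient u \<eta>" for u \<eta> x
    unfolding \<beta>_def
  proof (rule convex_on_upper_limit_dist)
    fix w
    obtain y where y: "w = f y" using surj by blast
    show "\<exists>a. \<forall>\<^sub>F n in sequentially. a \<le> norm (f (x + real n *\<^sub>R u) - w) - real n"
      using ev[OF that, of x y] unfolding y by (blast intro: eventually_mono)
    show "\<exists>a. \<forall>\<^sub>F n in sequentially. norm (f (x + real n *\<^sub>R u) - w) - real n \<le> a"
      using ev[OF that, of x y] unfolding y by (blast intro: eventually_mono)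
  qed
  have \<beta>_bd: "of_int \<lfloor>\<eta> (x - y)\<rfloor> \<le> \<beta> u x (f y)" "\<beta> u x (f y) \<le> of_int \<lfloor>\<eta> (x - y)\<rfloor> + 1"
    if "norm_gradient u \<eta>" for u \<eta> x y
  proof -
    have e: "\<forall>\<^sub>F n in sequentially. of_int \<lfloor>\<eta> (x - y)\<rfloor> \<le> norm (f (x + real n *\<^sub>R u) - f y) - real n"
      "\<forall>\<^sub>F n in sequentially. norm (f (x + real n *\<^sub>R u) - f y) - real n \<le> of_int \<lfloor>\<eta> (x - y)\<rfloor> + 1"
      using ev[OF that, of x y] by (auto elim: eventually_mono)
    show "of_int \<lfloor>\<eta> (x - y)\<rfloor> \<le> \<beta> u x (f y)" unfolding \<beta>_def by (rule upper_limit_ge[OF e])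
    show "\<beta> u x (f y) \<le> of_int \<lfloor>\<eta> (x - y)\<rfloor> + 1" unfolding \<beta>_def by (rule upper_limit_le[OF e])
  qed
  have v': "norm_gradient (- v) (\<lambda>x. - \<phi> x)" by (rule norm_gradient_uminus[OF v])
  have lin_\<beta>: "linear (\<lambda>w. \<beta> v x w - \<beta> v x 0)" for x
  proof (rule linear_if_convex_sum_bounded[OF \<beta>_conv[OF v] \<beta>_conv[OF v']])
    fix w
    obtain y where y: "w = f y" using surj by blast
    show "\<bar>\<beta> v x w + \<beta> (- v) x w\<bar> \<le> 2"
      using \<beta>_bd[OF v, of x y] \<beta>_bd[OF v', of x y] unfolding y by linarith
  qed
  define \<psi> where "\<psi> = (\<lambda>w. - (\<beta> v 0 w - \<beta> v 0 0))"
  have lin_\<psi>: "linear \<psi>" unfolding \<psi>_def by (rule linear_compose_neg[OF lin_\<beta>])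
  have \<beta>_eq: "\<beta> v x w = \<beta> v x 0 - \<psi> w" for x w
  proof -
    have "(\<beta> v x w - \<beta> v x 0) + \<psi> w = 0"
    proof (rule linear_bounded_imp_0[where \<psi> = "\<lambda>w. (\<beta> v x w - \<beta> v x 0) + \<psi> w"])
      show "linear (\<lambda>w. (\<beta> v x w - \<beta> v x 0) + \<psi> w)" by (rule linear_compose_add[OF lin_\<beta> lin_\<psi>])
      fix w
      obtain y where y: "w = f y" using surj by blast
      have "\<bar>\<beta> v x w - \<phi> (x - y)\<bar> \<le> 1" using \<beta>_bd[OF v, of x y] unfolding y by linarith
      moreover have "\<bar>\<beta> v 0 w - \<phi> (0 - y)\<bar> \<le> 1" using \<beta>_bd[OF v, of 0 y] unfolding y by linarith
      ultimately show "\<bar>(\<beta> v x w - \<beta> v x 0) + \<psi> w\<bar> \<le> 2 + \<bar>\<phi> x\<bar> + \<bar>\<beta> v x 0\<bar> + \<bar>\<beta> v 0 0\<bar>"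
        unfolding \<psi>_def using linear_diff[OF lin, of x y] linear_diff[OF lin, of 0 y] linear_0[OF lin]
        by linarith
    qed
    then show ?thesis by simp
  qed
  have "\<psi> (f y) \<le> \<psi> (f y')" if "\<phi> y < \<phi> y'" for y y'
  proof -
    \<comment> \<open>Seen from the base point \<open>y\<close>, the levels of \<open>y\<close> and \<open>y'\<close> round to \<open>0\<close> and to at most \<open>- 1\<close>.\<close>
    have "\<lfloor>\<phi> (y - y')\<rfloor> \<le> -1" using that linear_diff[OF lin, of y y'] by linarith
    then have "\<beta> v y (f y') \<le> 0" using \<beta>_bd(2)[OF v, of y y'] by linarith
    moreover have "0 \<le> \<beta> v y (f y)" using \<beta>_bd(1)[OF v, of y y] linear_0[OF lin] by simp
    ultimately show ?thesis using \<beta>_eq[of y "f y"] \<beta>_eq[of y "f y'"] by linarith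
  qed
  moreover have "\<bar>\<psi> (f y) - \<phi> y - \<beta> v 0 0\<bar> \<le> 1" for y
    using \<beta>_bd[OF v, of 0 y] linear_diff[OF lin, of 0 y] linear_0[OF lin] unfolding \<psi>_def by simp linarith
  ultimately show ?thesis unfolding transports_def using lin_\<psi> by blast
qed

section \<open>The linear isometry near a step-isometry\<close>

lemma transports_diff:
  assumes "transports f \<phi> \<psi>"
  shows "\<bar>(\<psi> (f y) - \<psi> (f y')) - (\<phi> y - \<phi> y')\<bar> \<le> 2"
proof -
  obtain k where k: "\<And>y. \<bar>\<psi> (f y) - \<phi> y - k\<bar> \<le> 1"
    using assms unfolding transports_def by blast
  show ?thesis using k[of y] k[of y'] by linarith
qed

text \<open>The estimate holds up to an additive constant by comparison of distances; the constant is removed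
  by scaling.\<close>

lemma transports_le_norm:
  assumes f: "step_isometry_on UNIV f" and \<phi>: "smooth_functional \<phi>" and \<psi>: "transports f \<phi> \<psi>"
  shows "\<bar>\<psi> w\<bar> \<le> norm w"
proof -
  have lin: "linear \<psi>" using \<psi> unfolding transports_def by blast
  have surj: "\<exists>y. w = f y" for w
    using step_isometry_on_UNIV_D(1)[OF f] by (metis bij_pointE)
  have coarse: "\<bar>\<psi> w\<bar> \<le> norm w + 3" for w
  proof -
    obtain y y' where y: "w = f y" "0 = f y'" using surj by metis
    have "\<bar>\<phi> y - \<phi> y'\<bar> \<le> norm (y - y')"
      using smooth_functional_abs_le_norm[OF \<phi>, of "y - y'"] linear_diff[OF smooth_functional_linear[OF \<phi>]] by simp
    moreover have "norm (y - y') \<le> norm w + 1"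
      using step_isometry_on_UNIV_D(2)[OF f, of y y'] y by simp linarith
    moreover have "\<psi> (f y') = 0" using y(2) linear_0[OF lin] by simp
    ultimately show ?thesis using transports_diff[OF \<psi>, of y y'] unfolding y(1) by linarith
  qed
  show ?thesis
  proof (rule ccontr)
    assume "\<not> ?thesis"
    define d where "d = \<bar>\<psi> w\<bar> - norm w"
    with \<open>\<not> ?thesis\<close> have "d > 0" by simp
    define t where "t = 4 / d"
    have t: "t > 0" "t * d = 4" unfolding t_def using \<open>d > 0\<close> by auto
    have "t * \<bar>\<psi> w\<bar> \<le> t * norm w + 3"
      using coarse[of "t *\<^sub>R w"] t(1) linear_scale[OF lin, of t w] by (simp add: abs_mult)
    then show False using t(2) unfolding d_def by (simp add: algebra_simps)
  qed
qed

text \<open>If every transported functional vanished on \<open>z\<close>, the preimages of two far apart points of the line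
  through \<open>z\<close> would differ by at most \<open>2\<close> in every smooth functional, hence in norm.\<close>

lemma transported_functionals_separate:
  fixes f :: "'v::real_normed_vector \<Rightarrow> 'v"
  assumes fd: "finite_dimensional TYPE('v)" and f: "step_isometry_on UNIV f"
    and z: "\<And>\<phi> \<psi>. smooth_functional \<phi> \<Longrightarrow> transports f \<phi> \<psi> \<Longrightarrow> \<psi> z = 0"
  shows "z = 0"
proof (rule ccontr)
  assume "z \<noteq> 0"
  \<comment> \<open>Distance \<open>3\<close> is too far for preimages at distance at most \<open>2\<close>.\<close>
  define t where "t = 3 / norm z"
  have surj: "\<exists>y. w = f y" for w
    using step_isometry_on_UNIV_D(1)[OF f] by (metis bij_pointE)
  obtain y y' where y: "t *\<^sub>R z = f y" "0 = f y'" using surj by metis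
  have "norm (y - y') \<le> 2"
  proof (rule norm_le_if_smooth_functionals_le[OF fd])
    fix \<phi> :: "'v \<Rightarrow> real" assume \<phi>: "smooth_functional \<phi>"
    obtain \<psi> where \<psi>: "transports f \<phi> \<psi>" using step_isometry_transports[OF f \<phi>] by blast
    have lin: "linear \<psi>" using \<psi> unfolding transports_def by blast
    have "\<psi> (f y) = 0" "\<psi> (f y') = 0"
      using z[OF \<phi> \<psi>] linear_scale[OF lin, of t z] linear_0[OF lin] y by (metis mult_zero_right real_scaleR_def)+
    then show "\<phi> (y - y') \<le> 2"
      using transports_diff[OF \<psi>, of y y'] linear_diff[OF smooth_functional_linear[OF \<phi>], of y y'] by linarith
  qed simp
  then have "\<lfloor>norm (f y - f y')\<rfloor> < 3" using step_isometry_on_UNIV_D(2)[OF f, of y y'] by linarith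
  moreover have "norm (f y - f y') = 3" using \<open>z \<noteq> 0\<close> y unfolding t_def by (metis diff_zero 
    norm_scaleR abs_norm_cancel abs_divide nonzero_eq_divide_eq norm_eq_zero abs_numeral)
  ultimately show False by simp
qed

text \<open>The vector \<open>z\<close> is a limit of a subsequence of \<open>f (n x) / n\<close>.  Since \<open>f\<close> distorts distances by at most \<open>1\<close>
  and transported functionals by at most \<open>2\<close>, the errors vanish after division by \<open>n\<close>.\<close>

lemma asymptotic_image_exists:
  fixes f :: "'v::real_normed_vector \<Rightarrow> 'v"
  assumes fd: "finite_dimensional TYPE('v)" and f: "step_isometry_on UNIV f"
  shows "\<exists>z. norm z = norm x \<and> (\<forall>\<phi> \<psi>. smooth_functional \<phi> \<longrightarrow> transports f \<phi> \<psi> \<longrightarrow> \<psi> z = \<phi> x)"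
proof -
  define Y where "Y = (\<lambda>n. (1 / real (Suc n)) *\<^sub>R (f (real (Suc n) *\<^sub>R x) - f 0))"
  have Y_norm: "\<bar>norm (Y n) - norm x\<bar> \<le> 1 / real (Suc n)" for n
  proof -
    have "\<bar>norm (f (real (Suc n) *\<^sub>R x) - f 0) - norm (real (Suc n) *\<^sub>R x)\<bar> \<le> 1"
      using step_isometry_on_UNIV_D(2)[OF f, of "real (Suc n) *\<^sub>R x" 0] unfolding diff_zero by linarith
    then have "(1 / real (Suc n)) * \<bar>norm (f (real (Suc n) *\<^sub>R x) - f 0) - real (Suc n) * norm x\<bar> 
      \<le> (1 / real (Suc n)) * 1"
      by (intro mult_left_mono) simp_all
    moreover have "norm (Y n) - norm x 
      = (1 / real (Suc n)) * (norm (f (real (Suc n) *\<^sub>R x) - f 0) - real (Suc n) * norm x)"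
      unfolding Y_def by (simp add: right_diff_distrib del: of_nat_Suc)
    ultimately show ?thesis by (simp add: abs_mult del: of_nat_Suc)
  qed
  have inv0: "(\<lambda>n. c / real (Suc n)) \<longlonglongrightarrow> 0" for c
    using LIMSEQ_Suc[OF lim_const_over_n[of c]] by simp
  have Y_lim: "(\<lambda>n. norm (Y n)) \<longlonglongrightarrow> norm x"
    by (rule LIM_zero_cancel, rule Lim_null_comparison[OF _ inv0[of 1]]) (use Y_norm in auto)
  have "Y n \<in> cball 0 (norm x + 1)" for n
  proof -
    have "1 / real (Suc n) \<le> 1" by simp
    then have "norm (Y n) \<le> norm x + 1" using Y_norm[of n] by linarith
    then show ?thesis by simp
  qed
  then obtain z s where zs: "strict_mono s" "(Y \<circ> s) \<longlonglongrightarrow> z"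
    using compact_cball_finite_dimensional[OF fd, of 0 "norm x + 1"] unfolding compact_def by metis
  have "((\<lambda>n. norm (Y n)) \<circ> s) \<longlonglongrightarrow> norm x" by (rule LIMSEQ_subseq_LIMSEQ[OF Y_lim zs(1)])
  moreover have "((\<lambda>n. norm (Y n)) \<circ> s) \<longlonglongrightarrow> norm z"
    using tendsto_norm[OF zs(2)] by (simp add: o_def)
  ultimately have "norm z = norm x" by (rule LIMSEQ_unique[rotated])
  moreover have "\<psi> z = \<phi> x" if \<phi>: "smooth_functional \<phi>" and \<psi>: "transports f \<phi> \<psi>" for \<phi> \<psi>
  proof -
    have lin: "linear \<psi>" using \<psi> unfolding transports_def by blast
    have bl: "bounded_linear \<psi>"
      by (rule bounded_linear_intro[where K = 1])
        (use lin transports_le_norm[OF f \<phi> \<psi>] in \<open>auto simp: linear_add linear_scale\<close>)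
    have lim: "((\<lambda>n. \<psi> (Y n)) \<circ> s) \<longlonglongrightarrow> \<psi> z"
      using bounded_linear.tendsto[OF bl zs(2)] by (simp add: o_def)
    have "\<bar>\<psi> (Y n) - \<phi> x\<bar> \<le> 2 / real (Suc n)" for n
    proof -
      let ?k = "real (Suc n)"
      have "\<bar>(\<psi> (f (?k *\<^sub>R x)) - \<psi> (f 0)) - ?k * \<phi> x\<bar> \<le> 2"
        using transports_diff[OF \<psi>, of "?k *\<^sub>R x" 0] 
          linear_scale[OF smooth_functional_linear[OF \<phi>], of ?k x] linear_0[OF smooth_functional_linear[OF \<phi>]]
        by simp
      then have "(1 / ?k) * \<bar>(\<psi> (f (?k *\<^sub>R x)) - \<psi> (f 0)) - ?k * \<phi> x\<bar> \<le> (1 / ?k) * 2"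
        by (intro mult_left_mono) simp_all
      moreover have "\<psi> (Y n) - \<phi> x = (1 / ?k) * ((\<psi> (f (?k *\<^sub>R x)) - \<psi> (f 0)) - ?k * \<phi> x)"
        unfolding Y_def by (simp add: linear_scale[OF lin] linear_diff[OF lin] right_diff_distrib del: of_nat_Suc)
      ultimately show ?thesis by (simp add: abs_mult del: of_nat_Suc)
    qed
    then have "(\<lambda>n. \<psi> (Y n)) \<longlonglongrightarrow> \<phi> x"
      by (intro LIM_zero_cancel[OF Lim_null_comparison[OF _ inv0[of 2]]]) auto
    then have "((\<lambda>n. \<psi> (Y n)) \<circ> s) \<longlonglongrightarrow> \<phi> x" by (rule LIMSEQ_subseq_LIMSEQ[OF _ zs(1)])
    then show ?thesis using lim LIMSEQ_unique by blast
  qed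
  ultimately show ?thesis by blast
qed

text \<open>The asymptotic image of \<open>x\<close> is linear in \<open>x\<close> because transported functionals separate points, so
  that it is determined by the values \<open>\<phi> x\<close>.\<close>

lemma step_isometry_near_linear_isometry:
  fixes f :: "'v::real_normed_vector \<Rightarrow> 'v"
  assumes fd: "finite_dimensional TYPE('v)" and f: "step_isometry_on UNIV f"
  obtains T g where "linear T" "bij T" "\<And>x. norm (T x) = norm x" "\<And>x. f x = T (g x)"
    "step_isometry_on UNIV g" "\<And>\<phi>. smooth_functional \<phi> \<Longrightarrow> transports g \<phi> \<phi>"
proof -
  obtain T where T: "\<And>x. norm (T x) = norm x"
    "\<And>x \<phi> \<psi>. smooth_functional \<phi> \<Longrightarrow> transports f \<phi> \<psi> \<Longrightarrow> \<psi> (T x) = \<phi> x"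
    using asymptotic_image_exists[OF fd f] by metis
  have lin_tr: "linear \<psi>" if "transports f \<phi> \<psi>" for \<phi> \<psi> using that unfolding transports_def by blast
  have lin: "linear T"
  proof (rule linearI)
    fix x y c
    have "T (x + y) - (T x + T y) = 0"
      by (rule transported_functionals_separate[OF fd f])
        (simp add: linear_diff[OF lin_tr] linear_add[OF lin_tr] T(2) linear_add[OF smooth_functional_linear])
    then show "T (x + y) = T x + T y" by simp
    have "T (c *\<^sub>R x) - c *\<^sub>R T x = 0"
      by (rule transported_functionals_separate[OF fd f])
        (simp add: linear_diff[OF lin_tr] linear_scale[OF lin_tr] T(2) linear_scale[OF smooth_functional_linear])
    then show "T (c *\<^sub>R x) = c *\<^sub>R T x" by simp
  qed
  have inj: "inj T" unfolding linear_injective_0[OF lin] using T(1) by (metis norm_eq_zero)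
  have bij: "bij T" using inj finite_dimensional_inj_imp_surj[OF fd lin inj] by (simp add: bij_def)
  define g where "g = inv T \<circ> f"
  have fg: "f x = T (g x)" for x unfolding g_def using bij by (simp add: bij_is_surj surj_f_inv_f)
  have "step_isometry_on UNIV g"
  proof -
    have "norm (g x - g y) = norm (f x - f y)" for x y
      using T(1)[of "g x - g y"] linear_diff[OF lin] fg by simp
    moreover have "bij g" unfolding g_def
      by (intro bij_comp step_isometry_on_UNIV_D(1)[OF f] bij_imp_bij_inv bij)
    ultimately show ?thesis using step_isometry_on_UNIV_D(2)[OF f] unfolding step_isometry_on_def by simp
  qed
  moreover have "transports g \<phi> \<phi>" if \<phi>: "smooth_functional \<phi>" for \<phi>
  proof -
    obtain \<psi> where \<psi>: "transports f \<phi> \<psi>" using step_isometry_transports[OF f \<phi>] by blast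
    have "\<phi> (g y) = \<psi> (f y)" for y using T(2)[OF \<phi> \<psi>] fg by simp
    then show ?thesis using \<psi> smooth_functional_linear[OF \<phi>] unfolding transports_def by simp
  qed
  ultimately show thesis using that[OF lin bij T(1) fg] by blast
qed

section \<open>Rigidity along functionals that satisfy a linear relation\<close>

text \<open>In finite dimension this says by duality that \<open>\<phi>\<close> is not in the span of the smooth functionals other
  than \<open>\<phi>\<close> and \<open>- \<phi>\<close>.  The vector \<open>w\<close> is what splits off as a direct summand.\<close>

definition free_functional :: "('v::real_normed_vector \<Rightarrow> real) \<Rightarrow> bool" where
  "free_functional \<phi> \<longleftrightarrow> smooth_functional \<phi> \<and>
     (\<exists>w. \<phi> w \<noteq> 0 \<and> (\<forall>\<eta>. smooth_functional \<eta> \<longrightarrow> \<eta> \<noteq> \<phi> \<longrightarrow> \<eta> \<noteq> (\<lambda>x. - \<phi> x) \<longrightarrow> \<eta> w = 0))"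

text \<open>The places where the monotone relation between \<open>\<phi> y\<close> and \<open>\<phi> (f y)\<close> fails to be a function.\<close>

definition jump_values :: "('v::real_normed_vector \<Rightarrow> 'v) \<Rightarrow> ('v \<Rightarrow> real) \<Rightarrow> real set" where
  "jump_values f \<phi> = {t. \<exists>y y'. \<phi> y = t \<and> \<phi> y' = t \<and> \<phi> (f y) < \<phi> (f y')}"

lemma not_jump_value:
  assumes "\<phi> y = \<phi> y'" "\<phi> y \<notin> jump_values f \<phi>"
  shows "\<phi> (f y) = \<phi> (f y')"
  using assms unfolding jump_values_def by (smt (verit) mem_Collect_eq)

text \<open>By monotonicity the gaps at different jumps are disjoint, so they contain different rationals.\<close>

lemma countable_jump_values:
  assumes mono: "\<And>y y'. \<phi> y < \<phi> y' \<Longrightarrow> \<phi> (f y) \<le> \<phi> (f y')"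
  shows "countable (jump_values f \<phi>)"
proof -
  have "\<exists>q y y'. \<phi> y = t \<and> \<phi> y' = t \<and> \<phi> (f y) < of_rat q \<and> of_rat q < \<phi> (f y')"
    if "t \<in> jump_values f \<phi>" for t
    using that of_rat_dense unfolding jump_values_def by blast
  then obtain q Y Y' where q: "\<And>t. t \<in> jump_values f \<phi> \<Longrightarrow>
    \<phi> (Y t) = t \<and> \<phi> (Y' t) = t \<and> \<phi> (f (Y t)) < of_rat (q t) \<and> of_rat (q t) < \<phi> (f (Y' t))"
    by metis
  have less: "q s < q t" if st: "s \<in> jump_values f \<phi>" "t \<in> jump_values f \<phi>" "s < t" for s t
  proof -
    have "\<phi> (f (Y' s)) \<le> \<phi> (f (Y t))" using mono[of "Y' s" "Y t"] q[OF st(1)] q[OF st(2)] st(3) by simp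
    then have "(of_rat (q s) :: real) < of_rat (q t)" using q[OF st(1)] q[OF st(2)] by linarith
    then show ?thesis by (simp add: of_rat_less)
  qed
  then have "inj_on q (jump_values f \<phi>)"
    by (intro inj_onI) (metis less_irrefl linorder_neqE)
  then show ?thesis by (rule countable_image_inj_on[rotated]) simp
qed

lemma common_nonzero_point:
  fixes \<Phi> :: "('v::real_vector \<Rightarrow> real) set"
  assumes "finite \<Phi>" "\<And>\<eta>. \<eta> \<in> \<Phi> \<Longrightarrow> linear \<eta> \<and> (\<exists>x. \<eta> x \<noteq> 0)"
  shows "\<exists>w. \<forall>\<eta>\<in>\<Phi>. \<eta> w \<noteq> 0"
  using assms
proof (induction rule: finite_induct)
  case (insert \<eta> \<Phi>)
  then obtain w where w: "\<forall>\<zeta>\<in>\<Phi>. \<zeta> w \<noteq> 0" by auto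
  obtain u where u: "\<eta> u \<noteq> 0" using insert.prems by blast
  have lin: "linear \<zeta>" if "\<zeta> \<in> insert \<eta> \<Phi>" for \<zeta> using insert.prems that by blast
  obtain e where e: "e \<notin> (\<lambda>\<zeta>. - \<zeta> w / \<zeta> u) ` insert \<eta> \<Phi>"
    using ex_new_if_finite[OF infinite_UNIV_char_0, of "(\<lambda>\<zeta>. - \<zeta> w / \<zeta> u) ` insert \<eta> \<Phi>"] insert.hyps(1)
    by blast
  have "\<zeta> (w + e *\<^sub>R u) \<noteq> 0" if \<zeta>: "\<zeta> \<in> insert \<eta> \<Phi>" for \<zeta>
  proof
    assume "\<zeta> (w + e *\<^sub>R u) = 0"
    then have *: "\<zeta> w + e * \<zeta> u = 0" using linear_add[OF lin[OF \<zeta>]] linear_scale[OF lin[OF \<zeta>]] by simp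
    have "\<zeta> u \<noteq> 0" using * u w \<zeta> by auto
    then have "e = - \<zeta> w / \<zeta> u" using * by (simp add: field_simps add_eq_0_iff)
    then show False using e \<zeta> by blast
  qed
  then show ?case by blast
qed simp

text \<open>On a line in a direction on which no functional vanishes, each functional excludes only countably
  many points.\<close>

lemma generic_point:
  fixes \<Phi> :: "('v::real_vector \<Rightarrow> real) set"
  assumes fin: "finite \<Phi>" and lin: "\<And>\<eta>. \<eta> \<in> \<Phi> \<Longrightarrow> linear \<eta> \<and> (\<exists>x. \<eta> x \<noteq> 0)"
    and count: "\<And>\<eta>. \<eta> \<in> \<Phi> \<Longrightarrow> countable (N \<eta>)"
  shows "\<exists>y. \<forall>\<eta>\<in>\<Phi>. \<eta> y \<notin> N \<eta>"
proof -
  obtain w where w: "\<forall>\<eta>\<in>\<Phi>. \<eta> w \<noteq> 0" using common_nonzero_point[OF fin lin] by blast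
  have "countable (\<Union>\<eta>\<in>\<Phi>. (\<lambda>b. b / \<eta> w) ` N \<eta>)"
    using fin count by (intro countable_UN countable_image) (auto intro: countable_finite)
  then obtain c where c: "c \<notin> (\<Union>\<eta>\<in>\<Phi>. (\<lambda>b. b / \<eta> w) ` N \<eta>)"
    using uncountable_UNIV_real by (metis UNIV_eq_I)
  have "\<eta> (c *\<^sub>R w) \<notin> N \<eta>" if "\<eta> \<in> \<Phi>" for \<eta>
  proof
    assume "\<eta> (c *\<^sub>R w) \<in> N \<eta>"
    moreover have "c = \<eta> (c *\<^sub>R w) / \<eta> w" 
      using lin[OF that] w that by (simp add: linear_scale)
    ultimately show False using c that by blast
  qed
  then show ?thesis by blast
qed

lemma smooth_functional_nonzero: "smooth_functional \<phi> \<Longrightarrow> \<exists>x. \<phi> x \<noteq> 0"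
  unfolding smooth_functional_def using norm_gradient_self by (metis zero_neq_one)

text \<open>Both functionals have norm \<open>1\<close>.\<close>

lemma smooth_functionals_proportional:
  assumes \<phi>: "smooth_functional \<phi>" and \<eta>: "smooth_functional \<eta>" and c: "\<And>x. \<phi> x = c * \<eta> x"
  shows "\<phi> = \<eta> \<or> \<phi> = (\<lambda>x. - \<eta> x)"
proof -
  obtain u v where u: "norm u = 1" "\<phi> u = 1" and v: "norm v = 1" "\<eta> v = 1"
    using \<phi> \<eta> unfolding smooth_functional_def using norm_gradient_self norm_gradientD(1) by metis
  have "\<bar>c\<bar> \<le> 1" using smooth_functional_abs_le_norm[OF \<phi>, of v] c[of v] v by simp
  moreover have "1 \<le> \<bar>c\<bar>"
  proof -
    have "1 = \<bar>c\<bar> * \<bar>\<eta> u\<bar>" using c[of u] u(2) by (metis abs_mult abs_one)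
    also have "\<dots> \<le> \<bar>c\<bar> * 1" 
      using smooth_functional_abs_le_norm[OF \<eta>, of u] u by (intro mult_left_mono) auto
    finally show ?thesis by simp
  qed
  ultimately have "c = 1 \<or> c = -1" by linarith
  then show ?thesis using c by auto
qed

text \<open>A minimal set \<open>J\<close> of other functionals whose common kernel lies in that of \<open>\<phi>\<close> has a dual system \<open>e\<close>, by
  minimality, and all coefficients of the resulting relation are nonzero.  It has at least two
  elements, as \<open>\<phi>\<close> is not proportional to another smooth functional.  Two vectors of the dual
  system, normalised by \<open>\<phi>\<close>, are the directions \<open>a\<close> and \<open>b\<close>, in which \<open>\<phi>\<close> changes at the same rate
  while no functional of \<open>J\<close> changes in both.\<close>

lemma nonfree_functional_dependence:
  fixes \<phi> :: "'v::real_normed_vector \<Rightarrow> real"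
  assumes fd: "finite_dimensional TYPE('v)" and \<phi>: "smooth_functional \<phi>" and nf: "\<not> free_functional \<phi>"
  obtains J c a b where "finite J" "\<And>\<eta>. \<eta> \<in> J \<Longrightarrow> smooth_functional \<eta>"
    "\<And>y. \<phi> y = (\<Sum>\<eta>\<in>J. c \<eta> * \<eta> y)" "\<phi> a = 1" "\<phi> b = 1" "\<And>\<eta>. \<eta> \<in> J \<Longrightarrow> \<eta> a = 0 \<or> \<eta> b = 0"
proof -
  define Oth where "Oth = {\<eta>. smooth_functional \<eta> \<and> \<eta> \<noteq> \<phi> \<and> \<eta> \<noteq> (\<lambda>x. - \<phi> x)}"
  define K where "K = (\<lambda>J::('v \<Rightarrow> real) set. {x::'v. \<forall>\<eta>\<in>J. \<eta> x = 0})"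
  have linO: "\<eta> \<in> Oth \<Longrightarrow> linear \<eta>" for \<eta> unfolding Oth_def using smooth_functional_linear by blast
  have subK: "subspace (K J)" if "J \<subseteq> Oth" for J
    unfolding K_def using linO that
    by (intro subspaceI) (auto simp: linear_0 linear_add linear_scale subset_iff)
  \<comment> \<open>A finite set with common kernel of least dimension has the same common kernel as all of \<open>Oth\<close>.\<close>
  have "\<exists>J. finite J \<and> J \<subseteq> Oth \<and> (\<forall>x\<in>K J. \<phi> x = 0)"
  proof -
    obtain J where J: "finite J \<and> J \<subseteq> Oth" "\<And>J'. finite J' \<and> J' \<subseteq> Oth \<Longrightarrow> dim (K J) \<le> dim (K J')"
      using ex_has_least_nat[of "\<lambda>J. finite J \<and> J \<subseteq> Oth" "{}" "\<lambda>J. dim (K J)"] by auto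
    have "\<eta> x = 0" if "\<eta> \<in> Oth" "x \<in> K J" for \<eta> x
    proof -
      have "K (insert \<eta> J) = K J"
      proof (rule finite_dimensional_subspace_eqI[OF fd])
        show "subspace (K (insert \<eta> J))" "subspace (K J)" using J(1) that(1) by (auto intro!: subK)
        show "K (insert \<eta> J) \<subseteq> K J" unfolding K_def by auto
        show "dim (K J) \<le> dim (K (insert \<eta> J))" using J that(1) by auto
      qed
      then show ?thesis using that(2) unfolding K_def by blast
    qed
    then have "\<phi> x = 0" if "x \<in> K J" for x
      using that nf \<phi> unfolding free_functional_def Oth_def by blast
    then show ?thesis using J(1) by blast
  qed
  then obtain J where J: "finite J" "J \<subseteq> Oth" "\<And>x. x \<in> K J \<Longrightarrow> \<phi> x = 0"
    and least: "\<And>J'. finite J' \<Longrightarrow> J' \<subseteq> Oth \<Longrightarrow> (\<forall>x\<in>K J'. \<phi> x = 0) \<Longrightarrow> card J \<le> card J'"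
    using ex_has_least_nat[of "\<lambda>J. finite J \<and> J \<subseteq> Oth \<and> (\<forall>x\<in>K J. \<phi> x = 0)" _ card] by metis
  have "\<exists>x. (\<forall>\<zeta>\<in>J - {\<eta>}. \<zeta> x = 0) \<and> \<phi> x \<noteq> 0" if "\<eta> \<in> J" for \<eta>
  proof (rule ccontr)
    assume "\<not> ?thesis"
    then have "card J \<le> card (J - {\<eta>})" using J by (intro least) (auto simp: K_def)
    then show False using J(1) that by (metis card_Diff1_less not_le)
  qed
  then obtain e where e: "\<And>\<eta> \<zeta>. \<eta> \<in> J \<Longrightarrow> \<zeta> \<in> J \<Longrightarrow> \<zeta> \<noteq> \<eta> \<Longrightarrow> \<zeta> (e \<eta>) = 0" "\<And>\<eta>. \<eta> \<in> J \<Longrightarrow> \<phi> (e \<eta>) \<noteq> 0"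
    by (metis (no_types, lifting) Diff_iff singletonD)
  have e1: "\<eta> (e \<eta>) \<noteq> 0" if "\<eta> \<in> J" for \<eta>
  proof
    assume "\<eta> (e \<eta>) = 0"
    then have "e \<eta> \<in> K J" unfolding K_def using e(1)[OF that] by force
    then show False using J(3) e(2)[OF that] by blast
  qed
  have lin\<phi>: "linear \<phi>" by (rule smooth_functional_linear[OF \<phi>])
  define c where "c = (\<lambda>\<eta>. \<phi> (e \<eta>) / \<eta> (e \<eta>))"
  have sum: "\<phi> y = (\<Sum>\<eta>\<in>J. c \<eta> * \<eta> y)" for y
  proof -
    define z where "z = y - (\<Sum>\<eta>\<in>J. (\<eta> y / \<eta> (e \<eta>)) *\<^sub>R e \<eta>)"
    have "\<zeta> z = 0" if "\<zeta> \<in> J" for \<zeta>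
    proof -
      have lin: "linear \<zeta>" using that J(2) linO by blast
      have "\<zeta> z = \<zeta> y - (\<Sum>\<eta>\<in>J. (\<eta> y / \<eta> (e \<eta>)) * \<zeta> (e \<eta>))"
        unfolding z_def by (simp add: linear_diff[OF lin] linear_sum[OF lin] linear_scale[OF lin])
      also have "(\<Sum>\<eta>\<in>J. (\<eta> y / \<eta> (e \<eta>)) * \<zeta> (e \<eta>)) = (\<Sum>\<eta>\<in>J. if \<eta> = \<zeta> then \<zeta> y else 0)"
        by (rule sum.cong) (use e e1 that in auto)
      also have "\<dots> = \<zeta> y" using J(1) that by simp
      finally show ?thesis by simp
    qed
    then have "\<phi> z = 0" by (intro J(3)) (simp add: K_def)
    then have "\<phi> y = (\<Sum>\<eta>\<in>J. (\<eta> y / \<eta> (e \<eta>)) * \<phi> (e \<eta>))"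
      unfolding z_def by (simp add: linear_diff[OF lin\<phi>] linear_sum[OF lin\<phi>] linear_scale[OF lin\<phi>])
    also have "\<dots> = (\<Sum>\<eta>\<in>J. c \<eta> * \<eta> y)" unfolding c_def by (intro sum.cong) auto
    finally show ?thesis .
  qed
  have "J \<noteq> {}" using sum smooth_functional_nonzero[OF \<phi>] by auto
  then obtain j where j: "j \<in> J" by blast
  have "J \<noteq> {j}"
  proof
    assume "J = {j}"
    then have "\<phi> y = c j * j y" for y using sum[of y] by simp
    then have "\<phi> = j \<or> \<phi> = (\<lambda>x. - j x)"
      using smooth_functionals_proportional[OF \<phi>] j J(2) unfolding Oth_def by blast
    then have "j = \<phi> \<or> j = (\<lambda>x. - \<phi> x)" by auto
    then show False using j J(2) unfolding Oth_def by blast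
  qed
  then obtain k where k: "k \<in> J" "k \<noteq> j" using j by blast
  define a where "a = (1 / \<phi> (e j)) *\<^sub>R e j"
  define b where "b = (1 / \<phi> (e k)) *\<^sub>R e k"
  show thesis
  proof (rule that[OF J(1) _ sum])
    show "smooth_functional \<eta>" if "\<eta> \<in> J" for \<eta> using that J(2) unfolding Oth_def by blast
    show "\<phi> a = 1" "\<phi> b = 1" unfolding a_def b_def using e(2) j k by (simp_all add: linear_scale[OF lin\<phi>])
    show "\<eta> a = 0 \<or> \<eta> b = 0" if "\<eta> \<in> J" for \<eta>
    proof -
      have lin: "linear \<eta>" using that J(2) linO by blast
      show ?thesis unfolding a_def b_def linear_scale[OF lin] using e(1)[OF j that] e(1)[OF k(1) that] k(2) by auto
    qed
  qed
qed

text \<open>Let \<open>p s r = y + s a + r b\<close> with \<open>a\<close> and \<open>b\<close> from the linear relation.  The value of \<open>\<phi> \<circ> g\<close> at \<open>p s r\<close> depends only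
  on \<open>s + r\<close>, but by the relation it is also a function of \<open>s\<close> plus a function of \<open>r\<close>.  So it is
  additive in \<open>s + r\<close> up to a constant, and being close to the identity it is a translation.  All
  this holds as long as no jumps are met, which is arranged for rational \<open>s\<close> and \<open>r\<close> by a generic choice
  of \<open>y\<close>; monotonicity then extends the conclusion to all points.\<close>

lemma nonfree_functional_rigid:
  fixes g :: "'v::real_normed_vector \<Rightarrow> 'v"
  assumes fd: "finite_dimensional TYPE('v)" and \<phi>: "smooth_functional \<phi>" and nf: "\<not> free_functional \<phi>"
    and tr: "\<And>\<eta>. smooth_functional \<eta> \<Longrightarrow> transports g \<eta> \<eta>"
  shows "\<exists>k. \<forall>y. \<phi> (g y) = \<phi> y + k"
proof -
  obtain J c a b where J: "finite J" "\<And>\<eta>. \<eta> \<in> J \<Longrightarrow> smooth_functional \<eta>"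
    and sum: "\<And>y. \<phi> y = (\<Sum>\<eta>\<in>J. c \<eta> * \<eta> y)"
    and ab: "\<phi> a = 1" "\<phi> b = 1" "\<And>\<eta>. \<eta> \<in> J \<Longrightarrow> \<eta> a = 0 \<or> \<eta> b = 0"
    by (rule nonfree_functional_dependence[OF fd \<phi> nf]) (rule that)
  have mono: "\<eta> (g y) \<le> \<eta> (g y')" if "smooth_functional \<eta>" "\<eta> y < \<eta> y'" for \<eta> y y'
    using tr[OF that(1)] that(2) unfolding transports_def by blast
  \<comment> \<open>The values \<open>\<eta> y\<close> for which some \<open>y + s a + r b\<close> with rational \<open>s\<close> and \<open>r\<close> would lie at a jump.\<close>
  define N where "N = (\<lambda>\<eta>. \<Union>s\<in>\<rat>. \<Union>r\<in>\<rat>. (\<lambda>t. t - s * \<eta> a - r * \<eta> b) ` jump_values g \<eta>)"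
  have smJ: "smooth_functional \<eta>" if "\<eta> \<in> insert \<phi> J" for \<eta> using that J(2) \<phi> by blast
  have "\<exists>y. \<forall>\<eta>\<in>insert \<phi> J. \<eta> y \<notin> N \<eta>"
  proof (rule generic_point)
    show "finite (insert \<phi> J)" using J(1) by simp
    fix \<eta> assume \<eta>: "\<eta> \<in> insert \<phi> J"
    show "linear \<eta> \<and> (\<exists>x. \<eta> x \<noteq> 0)"
      using smooth_functional_linear smooth_functional_nonzero smJ[OF \<eta>] by blast
    have "countable (jump_values g \<eta>)" 
      by (rule countable_jump_values) (rule mono[OF smJ[OF \<eta>]])
    then show "countable (N \<eta>)" unfolding N_def by (intro countable_UN countable_image countable_rat)
  qed
  then obtain y where y: "\<And>\<eta>. \<eta> \<in> insert \<phi> J \<Longrightarrow> \<eta> y \<notin> N \<eta>" by blast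
  define p where "p = (\<lambda>s r. y + s *\<^sub>R a + r *\<^sub>R b)"
  have p_val: "\<eta> (p s r) = \<eta> y + s * \<eta> a + r * \<eta> b" if "\<eta> \<in> insert \<phi> J" for \<eta> s r
    unfolding p_def using smooth_functional_linear[OF smJ[OF that]] by (simp add: linear_add linear_scale)
  have generic: "\<eta> (p s r) \<notin> jump_values g \<eta>" if "\<eta> \<in> insert \<phi> J" "s \<in> \<rat>" "r \<in> \<rat>" for \<eta> s r
  proof
    assume "\<eta> (p s r) \<in> jump_values g \<eta>"
    moreover have "\<eta> y = \<eta> (p s r) - s * \<eta> a - r * \<eta> b" using p_val[OF that(1)] by simp
    ultimately have "\<eta> y \<in> N \<eta>" unfolding N_def using that(2,3) by blast
    then show False using y[OF that(1)] by blast
  qed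
  have eq: "\<eta> (g (p s r)) = \<eta> (g (p s' r'))"
    if "\<eta> \<in> insert \<phi> J" "s \<in> \<rat>" "r \<in> \<rat>" "s * \<eta> a + r * \<eta> b = s' * \<eta> a + r' * \<eta> b" for \<eta> s r s' r'
    by (rule not_jump_value[OF _ generic[OF that(1-3)]]) (use p_val[OF that(1)] that(4) in simp)
  define \<gamma> where "\<gamma> = (\<lambda>s. \<phi> (g (p s 0)))"
  have \<gamma>: "\<phi> (g (p s r)) = \<gamma> (s + r)" if "s \<in> \<rat>" "r \<in> \<rat>" for s r
    unfolding \<gamma>_def by (rule eq) (use that ab in auto)
  \<comment> \<open>Each summand of the relation ignores \<open>s\<close> or ignores \<open>r\<close>, so its mixed difference vanishes.\<close>
  have add: "\<gamma> (s + r) - \<gamma> s - \<gamma> r + \<gamma> 0 = 0" if s: "s \<in> \<rat>" and r: "r \<in> \<rat>" for s r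
  proof -
    have "\<eta> (g (p s r)) - \<eta> (g (p s 0)) - \<eta> (g (p 0 r)) + \<eta> (g (p 0 0)) = 0" if \<eta>: "\<eta> \<in> J" for \<eta>
      using ab(3)[OF \<eta>]
    proof
      assume "\<eta> a = 0"
      then have "\<eta> (g (p s r)) = \<eta> (g (p 0 r))" "\<eta> (g (p s 0)) = \<eta> (g (p 0 0))"
        using \<eta> s r by (auto intro!: eq)
      then show ?thesis by simp
    next
      assume "\<eta> b = 0"
      then have "\<eta> (g (p s r)) = \<eta> (g (p s 0))" "\<eta> (g (p 0 r)) = \<eta> (g (p 0 0))"
        using \<eta> s r by (auto intro!: eq)
      then show ?thesis by simp
    qed
    then have "(\<Sum>\<eta>\<in>J. c \<eta> * (\<eta> (g (p s r)) - \<eta> (g (p s 0)) - \<eta> (g (p 0 r)) + \<eta> (g (p 0 0)))) = 0"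
      by (intro sum.neutral) simp
    then have "\<phi> (g (p s r)) - \<phi> (g (p s 0)) - \<phi> (g (p 0 r)) + \<phi> (g (p 0 0)) = 0"
      unfolding sum by (simp add: algebra_simps sum.distrib sum_subtractf)
    then show ?thesis using \<gamma>[OF s r] \<gamma>[OF s, of 0] \<gamma>[of 0 r] \<gamma>[of 0 0] r by simp
  qed
  have \<gamma>_rat: "\<gamma> s = \<gamma> 0 + s" if s: "s \<in> \<rat>" for s
  proof -
    have mult: "\<gamma> (real n * s) - \<gamma> 0 = real n * (\<gamma> s - \<gamma> 0)" for n
    proof (induction n)
      case (Suc n)
      have "\<gamma> (real n * s + s) - \<gamma> (real n * s) - \<gamma> s + \<gamma> 0 = 0" using s by (intro add) auto
      then show ?case using Suc by (simp add: algebra_simps)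
    qed simp
    have bd: "\<bar>(\<gamma> t - \<gamma> 0) - t\<bar> \<le> 2" for t
      using transports_diff[OF tr[OF \<phi>], of "p t 0" "p 0 0"] p_val[of \<phi> t 0] p_val[of \<phi> 0 0] ab(1)
      unfolding \<gamma>_def by simp
    have "\<bar>\<gamma> s - \<gamma> 0 - s\<bar> * real n \<le> 2" for n
    proof -
      have "(\<gamma> s - \<gamma> 0 - s) * real n = (\<gamma> (real n * s) - \<gamma> 0) - real n * s"
        unfolding mult by (simp add: algebra_simps)
      then have "\<bar>(\<gamma> s - \<gamma> 0 - s) * real n\<bar> \<le> 2" using bd[of "real n * s"] by simp
      then show ?thesis by (simp add: abs_mult)
    qed
    then have "\<not> 0 < \<bar>\<gamma> s - \<gamma> 0 - s\<bar>"
      using reals_Archimedean3 by (metis less_le_not_le mult.commute)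
    then show ?thesis by simp
  qed
  have "\<phi> (g z) = \<phi> z + (\<gamma> 0 - \<phi> y)" for z
  proof (rule order_antisym)
    show "\<phi> (g z) \<le> \<phi> z + (\<gamma> 0 - \<phi> y)"
    proof (rule field_le_epsilon)
      fix e :: real assume "e > 0"
      then obtain s where s: "s \<in> \<rat>" "\<phi> z - \<phi> y < s" "s < \<phi> z - \<phi> y + e"
        using Rats_dense_in_real[of "\<phi> z - \<phi> y" "\<phi> z - \<phi> y + e"] by auto
      have "\<phi> (g z) \<le> \<gamma> s" unfolding \<gamma>_def
        by (rule mono[OF \<phi>]) (use s p_val[of \<phi> s 0] ab(1) in simp)
      then show "\<phi> (g z) \<le> \<phi> z + (\<gamma> 0 - \<phi> y) + e" using \<gamma>_rat[OF s(1)] s(3) by linarith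
    qed
    show "\<phi> z + (\<gamma> 0 - \<phi> y) \<le> \<phi> (g z)"
    proof (rule field_le_epsilon)
      fix e :: real assume "e > 0"
      then obtain s where s: "s \<in> \<rat>" "\<phi> z - \<phi> y - e < s" "s < \<phi> z - \<phi> y"
        using Rats_dense_in_real[of "\<phi> z - \<phi> y - e" "\<phi> z - \<phi> y"] by auto
      have "\<gamma> s \<le> \<phi> (g z)" unfolding \<gamma>_def
        by (rule mono[OF \<phi>]) (use s p_val[of \<phi> s 0] ab(1) in simp)
      then show "\<phi> z + (\<gamma> 0 - \<phi> y) \<le> \<phi> (g z) + e" using \<gamma>_rat[OF s(1)] s(2) by linarith
    qed
  qed
  then show ?thesis by blast
qed

section \<open>Coordinates of a max-norm factor\<close>

lemma abs_le_linf_norm: "i < d \<Longrightarrow> \<bar>a i\<bar> \<le> linf_norm d a"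
  unfolding linf_norm_def by (intro Max_ge) auto

lemma linf_norm_le: "0 \<le> c \<Longrightarrow> (\<And>i. i < d \<Longrightarrow> \<bar>a i\<bar> \<le> c) \<Longrightarrow> linf_norm d a \<le> c"
  unfolding linf_norm_def by (subst Max_le_iff) auto

lemma linf_norm_nonneg: "0 \<le> linf_norm d a"
  unfolding linf_norm_def by (intro Max_ge) auto

lemma linf_norm_Suc: "linf_norm (Suc d) a = max (linf_norm d a) \<bar>a d\<bar>"
proof -
  have "insert 0 ((\<lambda>i. \<bar>a i\<bar>) ` {..<Suc d}) = insert \<bar>a d\<bar> (insert 0 ((\<lambda>i. \<bar>a i\<bar>) ` {..<d}))"
    by (auto simp: lessThan_Suc)
  then show ?thesis unfolding linf_norm_def by (simp add: max.commute)
qed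

lemma linf_norm_cong: "(\<And>i. i < d \<Longrightarrow> a i = b i) \<Longrightarrow> linf_norm d a = linf_norm d b"
  unfolding linf_norm_def by (intro arg_cong[of _ _ Max] arg_cong[of _ _ "insert 0"] image_cong) auto

text \<open>From a point far out on the \<open>i\<close>-th axis the max-norm distance sees the \<open>i\<close>-th coordinate only.\<close>

lemma linf_norm_peak:
  assumes "i < d" "\<And>j. j < d \<Longrightarrow> \<bar>a j\<bar> \<le> M" "2 * M \<le> n" "\<sigma> = 1 \<or> \<sigma> = -1"
  shows "linf_norm d (\<lambda>j. a j - (if j = i then \<sigma> * n else 0)) = n - \<sigma> * a i"
proof (rule order_antisym)
  have ai: "\<bar>a i\<bar> \<le> M" using assms by blast
  show "linf_norm d (\<lambda>j. a j - (if j = i then \<sigma> * n else 0)) \<le> n - \<sigma> * a i"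
  proof (rule linf_norm_le)
    have "\<bar>\<sigma> * a i\<bar> \<le> M" using ai assms(4) by auto
    then show "0 \<le> n - \<sigma> * a i" using assms(3) by linarith
    show "\<bar>a j - (if j = i then \<sigma> * n else 0)\<bar> \<le> n - \<sigma> * a i" if "j < d" for j
      using ai assms(2)[OF that] assms(3,4) by auto
  qed
  have "n - \<sigma> * a i \<le> \<bar>a i - \<sigma> * n\<bar>" using ai assms(3,4) by auto
  also have "\<dots> \<le> linf_norm d (\<lambda>j. a j - (if j = i then \<sigma> * n else 0))"
    using abs_le_linf_norm[OF assms(1), of "\<lambda>j. a j - (if j = i then \<sigma> * n else 0)"] by simp
  finally show "n - \<sigma> * a i \<le> linf_norm d (\<lambda>j. a j - (if j = i then \<sigma> * n else 0))" .
qed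

text \<open>A max-norm splitting in linear terms: \<open>P\<close> is the projection to \<open>W\<close> along \<open>U\<close>, the \<open>x i\<close> are the
  coordinates on \<open>W\<close>, extended by \<open>0\<close> on \<open>U\<close>, and the \<open>e i\<close> are the corresponding unit vectors.\<close>

locale linf_coordinates =
  fixes U W :: "'v::real_normed_vector set" and d :: nat
    and P :: "'v \<Rightarrow> 'v" and x :: "nat \<Rightarrow> 'v \<Rightarrow> real" and e :: "nat \<Rightarrow> 'v"
  assumes subspace_U: "subspace U" and subspace_W: "subspace W"
    and P_linear: "linear P" and P_in: "P v \<in> W" and P_diff: "v - P v \<in> U"
    and P_W: "w \<in> W \<Longrightarrow> P w = w" and P_U: "u \<in> U \<Longrightarrow> P u = 0"
    and norm_eq: "norm v = max (norm (v - P v)) (norm (P v))"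
    and x_linear: "i < d \<Longrightarrow> linear (x i)" and x_U: "i < d \<Longrightarrow> u \<in> U \<Longrightarrow> x i u = 0"
    and x_le: "i < d \<Longrightarrow> \<bar>x i v\<bar> \<le> norm (P v)"
    and norm_P_le: "0 \<le> c \<Longrightarrow> (\<And>i. i < d \<Longrightarrow> \<bar>x i v\<bar> \<le> c) \<Longrightarrow> norm (P v) \<le> c"
    and e_W: "i < d \<Longrightarrow> e i \<in> W"
    and x_e: "i < d \<Longrightarrow> j < d \<Longrightarrow> x j (e i) = (if j = i then 1 else 0)"

lemma direct_sum_projection:
  fixes U W :: "'v::real_vector set"
  assumes "direct_sum_decomposition U W"
  obtains P where "linear P" "\<And>v. P v \<in> W" "\<And>v. v - P v \<in> U" "\<And>w. w \<in> W \<Longrightarrow> P w = w"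
    "\<And>u. u \<in> U \<Longrightarrow> P u = 0"
proof -
  have U: "subspace U" and W: "subspace W" and int: "U \<inter> W = {0}"
    and cover: "\<And>v. \<exists>u\<in>U. \<exists>w\<in>W. v = u + w"
    using assms unfolding direct_sum_decomposition_def by auto
  have "\<exists>w. w \<in> W \<and> v - w \<in> U" for v
  proof -
    obtain u w where uw: "u \<in> U" "w \<in> W" "v = u + w" using cover[of v] by blast
    then have "v - w = u" by simp
    then show ?thesis using uw by blast
  qed
  then have "\<forall>v. \<exists>w. w \<in> W \<and> v - w \<in> U" by blast
  from choice[OF this] obtain P where "\<forall>v. P v \<in> W \<and> v - P v \<in> U" by (rule exE)
  then have P: "P v \<in> W" "v - P v \<in> U" for v by simp_all
  have unique: "P v = w" if "w \<in> W" "v - w \<in> U" for v w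
  proof -
    have "P v - w \<in> W" using W P(1) that(1) by (rule subspace_diff)
    moreover have "P v - w \<in> U"
    proof -
      have "(v - w) - (v - P v) = P v - w" by simp
      then show ?thesis using subspace_diff[OF U that(2) P(2)[of v]] by (simp only:)
    qed
    ultimately have "P v - w \<in> {0}" using int by blast
    then show ?thesis by simp
  qed
  have "linear P"
  proof (rule linearI)
    fix a b c
    show "P (a + b) = P a + P b"
    proof (rule unique)
      show "P a + P b \<in> W" by (rule subspace_add[OF W P(1) P(1)])
      have "a + b - (P a + P b) = (a - P a) + (b - P b)" by simp
      then show "a + b - (P a + P b) \<in> U" using subspace_add[OF U P(2)[of a] P(2)[of b]] by (simp only:)
    qed
    show "P (c *\<^sub>R a) = c *\<^sub>R P a"
    proof (rule unique)
      show "c *\<^sub>R P a \<in> W" by (rule subspace_scale[OF W P(1)])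
      show "c *\<^sub>R a - c *\<^sub>R P a \<in> U"
        using subspace_scale[OF U P(2)[of a], of c] by (simp only: scaleR_diff_right)
    qed
  qed
  moreover have "P w = w" if "w \<in> W" for w using that subspace_0[OF U] by (intro unique) simp_all
  moreover have "P u = 0" if "u \<in> U" for u using that subspace_0[OF W] by (intro unique) simp_all
  ultimately show thesis using that P by blast
qed

text \<open>The given isometry \<open>\<Phi>\<close> onto the max-norm space need not be linear, but each of its coordinates is affine: up to
  a constant, both the coordinate and its negative are distances from a far point on an axis,
  transported back to \<open>W\<close>, and distances are convex.\<close>

lemma linf_splitting_coordinates:
  fixes U W :: "'v::real_normed_vector set"
  assumes "linf_splitting U W d"
  obtains P x e where "linf_coordinates U W d P x e"
proof -
  have ds: "direct_sum_decomposition U W" and iso: "isometric_to_linf W d"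
    and max: "\<And>u w. u \<in> U \<Longrightarrow> w \<in> W \<Longrightarrow> norm (u + w) = max (norm u) (norm w)"
    using assms unfolding linf_splitting_def by auto
  have U: "subspace U" and W: "subspace W" using ds unfolding direct_sum_decomposition_def by auto
  obtain P where P: "linear P" "\<And>v. P v \<in> W" "\<And>v. v - P v \<in> U" "\<And>w. w \<in> W \<Longrightarrow> P w = w"
    "\<And>u. u \<in> U \<Longrightarrow> P u = 0"
    using direct_sum_projection[OF ds] by blast
  obtain \<Phi> where \<Phi>: "bij_betw \<Phi> W (linf_space d)"
    "\<And>v w. v \<in> W \<Longrightarrow> w \<in> W \<Longrightarrow> linf_norm d (\<lambda>i. \<Phi> v i - \<Phi> w i) = norm (v - w)"
    using iso unfolding isometric_to_linf_def by blast
  have \<Phi>_surj: "\<exists>w\<in>W. \<Phi> w = a" if "a \<in> linf_space d" for a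
    using \<Phi>(1) that unfolding bij_betw_def by (metis imageE)
  define x where "x = (\<lambda>i v. \<Phi> (P v) i - \<Phi> (P 0) i)"
  have P0: "P 0 = 0" by (rule linear_0[OF P(1)])
  have x_lin: "linear (x i)" if i: "i < d" for i
    unfolding x_def
  proof (rule linear_if_affine)
    fix t :: real and v v' :: 'v assume t: "0 \<le> t" "t \<le> 1"
    define z where "z = (1 - t) *\<^sub>R v + t *\<^sub>R v'"
    \<comment> \<open>Far enough out for \<open>linf_norm_peak\<close> at all three points.\<close>
    define n where "n = 2 * (linf_norm d (\<Phi> (P v)) + linf_norm d (\<Phi> (P v')) + linf_norm d (\<Phi> (P z)))"
    have convex: "n - \<sigma> * \<Phi> (P z) i \<le> (1 - t) * (n - \<sigma> * \<Phi> (P v) i) + t * (n - \<sigma> * \<Phi> (P v') i)"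
      if \<sigma>: "\<sigma> = 1 \<or> \<sigma> = - 1" for \<sigma>
    proof -
      have "(\<lambda>j. if j = i then \<sigma> * n else 0) \<in> linf_space d" using i unfolding linf_space_def by auto
      then obtain p where p: "p \<in> W" "\<Phi> p = (\<lambda>j. if j = i then \<sigma> * n else 0)" using \<Phi>_surj by blast
      have dist: "norm (P y - p) = n - \<sigma> * \<Phi> (P y) i" if "2 * linf_norm d (\<Phi> (P y)) \<le> n" for y
        using \<Phi>(2)[OF P(2) p(1), of y] linf_norm_peak[OF i abs_le_linf_norm that \<sigma>] unfolding p(2) by simp
      have "P z = (1 - t) *\<^sub>R P v + t *\<^sub>R P v'"
        unfolding z_def by (simp add: linear_add[OF P(1)] linear_scale[OF P(1)])
      then have "P z - p = (1 - t) *\<^sub>R (P v - p) + t *\<^sub>R (P v' - p)"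
        by (simp add: algebra_simps)
      then have "norm (P z - p) \<le> (1 - t) * norm (P v - p) + t * norm (P v' - p)"
        using norm_triangle_ineq[of "(1 - t) *\<^sub>R (P v - p)" "t *\<^sub>R (P v' - p)"] t by simp
      moreover have "2 * linf_norm d (\<Phi> (P z)) \<le> n" "2 * linf_norm d (\<Phi> (P v)) \<le> n" 
        "2 * linf_norm d (\<Phi> (P v')) \<le> n"
        unfolding n_def using linf_norm_nonneg[of d] by (simp_all add: add_nonneg_nonneg)
      ultimately show ?thesis using dist by simp
    qed
    show "\<Phi> (P z) i = (1 - t) * \<Phi> (P v) i + t * \<Phi> (P v') i"
      using convex[of 1] convex[of "-1"] by (simp add: algebra_simps)
  qed
  have norm_P: "norm (P v) = linf_norm d (\<lambda>i. x i v)" for v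
    using \<Phi>(2)[OF P(2) P(2), of v 0] unfolding x_def P0 by simp
  have "\<exists>w\<in>W. \<forall>j<d. x j w = (if j = i then 1 else 0)" if i: "i < d" for i
  proof -
    have "\<Phi> 0 \<in> linf_space d" using \<Phi>(1) subspace_0[OF W] unfolding bij_betw_def by blast
    then have "(\<lambda>j. \<Phi> 0 j + (if j = i then 1 else 0)) \<in> linf_space d" 
      using i unfolding linf_space_def by auto
    then obtain w where w: "w \<in> W" "\<Phi> w = (\<lambda>j. \<Phi> 0 j + (if j = i then 1 else 0))"
      using \<Phi>_surj by blast
    then show ?thesis unfolding x_def using P(4)[OF w(1)] P0 by (intro bexI[of _ w]) auto
  qed
  then obtain e where e: "\<And>i. i < d \<Longrightarrow> e i \<in> W" "\<And>i j. i < d \<Longrightarrow> j < d \<Longrightarrow> x j (e i) = (if j = i then 1 else 0)"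
    by metis
  have "linf_coordinates U W d P x e"
  proof (rule linf_coordinates.intro)
    show "norm v = max (norm (v - P v)) (norm (P v))" for v using max[OF P(3,2), of v v] by simp
    show "x i u = 0" if "i < d" "u \<in> U" for i u unfolding x_def using P(5)[OF that(2)] P0 by simp
    show "\<bar>x i v\<bar> \<le> norm (P v)" if "i < d" for i v
      unfolding norm_P using abs_le_linf_norm[OF that, of "\<lambda>i. x i v"] .
    show "norm (P v) \<le> c" if "0 \<le> c" "\<And>i. i < d \<Longrightarrow> \<bar>x i v\<bar> \<le> c" for c v
      unfolding norm_P using that by (rule linf_norm_le)
  qed (use U W P x_lin e in auto)
  then show thesis by (rule that)
qed

context linf_coordinates
begin

lemma x_le_norm: "i < d \<Longrightarrow> \<bar>x i v\<bar> \<le> norm v"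
  using x_le[of i v] norm_eq[of v] by linarith

lemma P_eq_0: "(\<And>i. i < d \<Longrightarrow> x i v = 0) \<Longrightarrow> P v = 0"
  using norm_P_le[of 0 v] by simp

lemma in_U_if: "P v = 0 \<Longrightarrow> v \<in> U"
  using P_diff[of v] by simp

lemma in_W_if: "v - P v = 0 \<Longrightarrow> v \<in> W"
  using P_in[of v] by simp

text \<open>Far out in the direction of \<open>e i\<close> the \<open>i\<close>-th coordinate dominates all others and the \<open>U\<close>-component.\<close>

lemma norm_gradient_coordinate:
  assumes i: "i < d"
  shows "norm_gradient (e i) (x i)"
  unfolding norm_gradient_def
proof (intro conjI allI)
  show lin: "linear (x i)" by (rule x_linear[OF i])
  have Pe: "P (e i) = e i" by (rule P_W[OF e_W[OF i]])
  have "norm (P (e i)) \<le> 1" using i x_e by (intro norm_P_le) auto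
  moreover have "1 \<le> norm (e i)" using x_le_norm[OF i, of "e i"] x_e[OF i i] by simp
  ultimately show "norm (e i) = 1" unfolding Pe by simp
  fix y
  have "norm (real n *\<^sub>R e i + y) - real n = x i y" if n: "2 * norm y \<le> real n" for n
  proof -
    let ?v = "real n *\<^sub>R e i + y"
    have xj: "x j ?v = (if j = i then real n else 0) + x j y" if "j < d" for j
      using x_linear[OF that] x_e[OF i that] by (simp add: linear_add linear_scale)
    have xi: "\<bar>x i y\<bar> \<le> norm y" by (rule x_le_norm[OF i])
    have diff: "?v - P ?v = y - P y"
      by (simp add: linear_add[OF P_linear] linear_scale[OF P_linear] Pe)
    have "norm (y - P y) \<le> norm y" using norm_eq[of y] by linarith
    then have 1: "norm (?v - P ?v) \<le> real n + x i y" unfolding diff using xi n by linarith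
    have 2: "norm (P ?v) \<le> real n + x i y"
    proof (rule norm_P_le)
      show "0 \<le> real n + x i y" using xi n by linarith
      show "\<bar>x j ?v\<bar> \<le> real n + x i y" if "j < d" for j
        using xj[OF that] xi n x_le_norm[OF that, of y] by auto
    qed
    have "norm ?v \<le> real n + x i y" using norm_eq[of ?v] 1 2 by simp
    moreover have "real n + x i y \<le> norm ?v" using x_le_norm[OF i, of ?v] xj[OF i] by simp
    ultimately show ?thesis by linarith
  qed
  moreover have "\<forall>\<^sub>F n in sequentially. 2 * norm y \<le> real n"
    using filterlim_real_sequentially unfolding filterlim_at_top by blast
  ultimately have "\<forall>\<^sub>F n in sequentially. norm (real n *\<^sub>R e i + y) - real n = x i y"
    by (auto elim: eventually_mono)
  then show "(\<lambda>n. norm (real n *\<^sub>R e i + y) - real n) \<longlonglongrightarrow> x i y" by (rule tendsto_eventually)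
qed

lemma smooth_coordinate: "i < d \<Longrightarrow> smooth_functional (x i)"
  using norm_gradient_coordinate unfolding smooth_functional_def by blast

text \<open>Let \<open>\<eta>\<close> be the derivative at \<open>v\<close>.  If the \<open>W\<close>-component of \<open>v\<close> is shorter than its
  \<open>U\<close>-component, it does not influence the norm near \<open>v\<close>.  Otherwise some coordinate of \<open>v\<close> attains
  the norm; up to sign this coordinate is then a lower bound for \<open>\<eta>\<close>, and a linear lower bound of
  a linear functional is equal to it.\<close>

lemma smooth_functional_cases:
  assumes "smooth_functional \<eta>"
  shows "(\<exists>i<d. \<eta> = x i \<or> \<eta> = (\<lambda>v. - x i v)) \<or> (\<forall>w\<in>W. \<eta> w = 0)"
proof -
  obtain v where v: "norm_gradient v \<eta>" using assms unfolding smooth_functional_def by blast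
  have nv: "norm v = 1" and lin: "linear \<eta>"
    and lim: "\<And>y. (\<lambda>n. norm (real n *\<^sub>R v + y) - real n) \<longlonglongrightarrow> \<eta> y"
    using norm_gradientD[OF v] by auto
  show ?thesis
  proof (cases "norm (P v) < 1")
    case True
    then have nu: "norm (v - P v) = 1" using norm_eq[of v] nv by linarith
    have "\<eta> w = 0" if w: "w \<in> W" for w
    proof -
      have "norm (real n *\<^sub>R v + w) - real n = 0" if n: "norm w / (1 - norm (P v)) \<le> real n" for n
      proof -
        have P: "P (real n *\<^sub>R v + w) = real n *\<^sub>R P v + w"
          by (simp add: linear_add[OF P_linear] linear_scale[OF P_linear] P_W[OF w])
        have "norm w \<le> real n * (1 - norm (P v))" using n True by (simp add: pos_divide_le_eq)
        then have "norm (real n *\<^sub>R P v + w) \<le> real n"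
          using norm_triangle_ineq[of "real n *\<^sub>R P v" w] by (simp add: algebra_simps)
        moreover have "norm ((real n *\<^sub>R v + w) - (real n *\<^sub>R P v + w)) = real n"
        proof -
          have "(real n *\<^sub>R v + w) - (real n *\<^sub>R P v + w) = real n *\<^sub>R (v - P v)" by (simp add: algebra_simps)
          then show ?thesis using nu by simp
        qed
        ultimately show ?thesis using norm_eq[of "real n *\<^sub>R v + w"] unfolding P by simp
      qed
      moreover have "\<forall>\<^sub>F n in sequentially. norm w / (1 - norm (P v)) \<le> real n"
        using filterlim_real_sequentially unfolding filterlim_at_top by blast
      ultimately have "\<forall>\<^sub>F n in sequentially. norm (real n *\<^sub>R v + w) - real n = 0"
        by (auto elim: eventually_mono)
      then have "(\<lambda>n. norm (real n *\<^sub>R v + w) - real n) \<longlonglongrightarrow> 0" by (rule tendsto_eventually)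
      then show ?thesis using lim[of w] LIMSEQ_unique by blast
    qed
    then show ?thesis by blast
  next
    case False
    have "\<exists>i<d. 1 \<le> \<bar>x i v\<bar>"
    proof (rule ccontr)
      assume "\<not> ?thesis"
      then have small: "\<And>i. i < d \<Longrightarrow> \<bar>x i v\<bar> < 1" by force
      have "linf_norm d (\<lambda>i. x i v) < 1"
        unfolding linf_norm_def using small by (subst Max_less_iff) auto
      moreover have "norm (P v) \<le> linf_norm d (\<lambda>i. x i v)"
        using abs_le_linf_norm[of _ d "\<lambda>i. x i v"] by (intro norm_P_le linf_norm_nonneg) auto
      ultimately show False using False by simp
    qed
    then obtain i where i: "i < d" "1 \<le> \<bar>x i v\<bar>" by blast
    define \<sigma> where "\<sigma> = sgn (x i v)"
    have \<sigma>: "\<sigma> = 1 \<or> \<sigma> = - 1" "\<sigma> * x i v = \<bar>x i v\<bar>" unfolding \<sigma>_def using i(2) by (auto simp: sgn_if)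
    have le: "\<sigma> * x i y \<le> \<eta> y" for y
    proof (rule LIMSEQ_le_const[OF lim], intro exI allI impI)
      fix n :: nat
      have "\<sigma> * x i (real n *\<^sub>R v + y) = real n * \<bar>x i v\<bar> + \<sigma> * x i y"
        using \<sigma>(2) x_linear[OF i(1)] by (simp add: linear_add linear_scale algebra_simps)
      moreover have "real n * 1 \<le> real n * \<bar>x i v\<bar>" using i(2) by (intro mult_left_mono) auto
      moreover have "\<sigma> * x i (real n *\<^sub>R v + y) \<le> norm (real n *\<^sub>R v + y)"
        using \<sigma>(1) x_le_norm[OF i(1), of "real n *\<^sub>R v + y"] by auto
      ultimately show "\<sigma> * x i y \<le> norm (real n *\<^sub>R v + y) - real n" by linarith
    qed
    have "\<eta> y = \<sigma> * x i y" for y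
      using le[of y] le[of "- y"] linear_neg[OF lin, of y] linear_neg[OF x_linear[OF i(1)], of y] by simp
    then have "\<eta> = x i \<or> \<eta> = (\<lambda>v. - x i v)" using \<sigma>(1) by auto
    then show ?thesis using i(1) by blast
  qed
qed

lemma free_coordinate:
  assumes i: "i < d"
  shows "free_functional (x i)"
  unfolding free_functional_def
proof (intro conjI exI allI impI)
  show "smooth_functional (x i)" by (rule smooth_coordinate[OF i])
  show "x i (e i) \<noteq> 0" using x_e[OF i i] by simp
  fix \<eta> assume \<eta>: "smooth_functional \<eta>" "\<eta> \<noteq> x i" "\<eta> \<noteq> (\<lambda>v. - x i v)"
  show "\<eta> (e i) = 0"
    using smooth_functional_cases[OF \<eta>(1)]
  proof
    assume "\<exists>j<d. \<eta> = x j \<or> \<eta> = (\<lambda>v. - x j v)"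
    then obtain j where j: "j < d" "\<eta> = x j \<or> \<eta> = (\<lambda>v. - x j v)" by blast
    then have "j \<noteq> i" using \<eta> by blast
    then show ?thesis using j x_e[OF i j(1)] by auto
  qed (use e_W[OF i] in blast)
qed

text \<open>Let \<open>w0\<close> be a vector with \<open>\<phi> w0 = 1\<close> on which all smooth functionals except \<open>\<phi>\<close> and \<open>- \<phi>\<close> vanish.  As
  the smooth functionals determine the norm, \<open>norm (y + t w0)\<close> is the maximum of \<open>norm y\<close> and \<open>\<bar>t\<bar>\<close> for
  \<open>y\<close> in the kernel of \<open>\<phi>\<close>.  So \<open>w0\<close> can be moved from \<open>U\<close> to the max-norm factor, with \<open>\<phi>\<close> as the new
  coordinate.\<close>

lemma linf_splitting_extend:
  assumes fd: "finite_dimensional TYPE('v)" and iso: "isometric_to_linf W d"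
    and free: "free_functional \<phi>" and other: "\<And>i. i < d \<Longrightarrow> \<phi> \<noteq> x i \<and> \<phi> \<noteq> (\<lambda>v. - x i v)"
  shows "\<exists>U' W'. linf_splitting U' W' (Suc d) \<and> W \<subset> W'"
proof -
  have sm: "smooth_functional \<phi>" using free unfolding free_functional_def by blast
  have lin: "linear \<phi>" by (rule smooth_functional_linear[OF sm])
  have \<phi>W: "\<phi> w = 0" if "w \<in> W" for w using smooth_functional_cases[OF sm] other that by blast
  obtain w1 where w1: "\<phi> w1 \<noteq> 0" 
    "\<And>\<eta>. smooth_functional \<eta> \<Longrightarrow> \<eta> \<noteq> \<phi> \<Longrightarrow> \<eta> \<noteq> (\<lambda>x. - \<phi> x) \<Longrightarrow> \<eta> w1 = 0"
    using free unfolding free_functional_def by blast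
  define w0 where "w0 = (1 / \<phi> w1) *\<^sub>R w1"
  have \<phi>w0: "\<phi> w0 = 1" unfolding w0_def using w1(1) by (simp add: linear_scale[OF lin])
  have w0: "\<eta> w0 = 0" if "smooth_functional \<eta>" "\<eta> \<noteq> \<phi>" "\<eta> \<noteq> (\<lambda>x. - \<phi> x)" for \<eta>
    unfolding w0_def using w1(2)[OF that] by (simp add: linear_scale[OF smooth_functional_linear[OF that(1)]])
  have "x i w0 = 0" if "i < d" for i
  proof (rule w0[OF smooth_coordinate[OF that]])
    show "x i \<noteq> \<phi>" "x i \<noteq> (\<lambda>x. - \<phi> x)" using other[OF that] by auto
  qed
  then have Pw0: "P w0 = 0" by (rule P_eq_0)
  have w0U: "w0 \<in> U" by (rule in_U_if[OF Pw0])
  have key: "norm (y + t *\<^sub>R w0) = max (norm y) \<bar>t\<bar>" if y: "\<phi> y = 0" for y t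
  proof (rule order_antisym)
    show "norm (y + t *\<^sub>R w0) \<le> max (norm y) \<bar>t\<bar>"
    proof (rule norm_le_if_smooth_functionals_le[OF fd])
      fix \<eta> :: "'v \<Rightarrow> real" assume \<eta>: "smooth_functional \<eta>"
      have val: "\<eta> (y + t *\<^sub>R w0) = \<eta> y + t * \<eta> w0"
        using smooth_functional_linear[OF \<eta>] by (simp add: linear_add linear_scale)
      show "\<eta> (y + t *\<^sub>R w0) \<le> max (norm y) \<bar>t\<bar>"
      proof (cases "\<eta> = \<phi> \<or> \<eta> = (\<lambda>x. - \<phi> x)")
        case True
        then show ?thesis using val y \<phi>w0 by auto
      next
        case False
        then show ?thesis using val w0[OF \<eta>] smooth_functional_le_norm[OF \<eta>, of y] by simp
      qed
    qed simp
    have "\<bar>t\<bar> \<le> norm (y + t *\<^sub>R w0)"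
      using smooth_functional_abs_le_norm[OF sm, of "y + t *\<^sub>R w0"] y \<phi>w0
      by (simp add: linear_add[OF lin] linear_scale[OF lin])
    moreover have "norm y \<le> norm (y + t *\<^sub>R w0)"
    proof (rule norm_le_if_smooth_functionals_le[OF fd])
      fix \<eta> :: "'v \<Rightarrow> real" assume \<eta>: "smooth_functional \<eta>"
      show "\<eta> y \<le> norm (y + t *\<^sub>R w0)"
      proof (cases "\<eta> = \<phi> \<or> \<eta> = (\<lambda>x. - \<phi> x)")
        case True
        then show ?thesis using y by auto
      next
        case False
        then have "\<eta> y = \<eta> (y + t *\<^sub>R w0)"
          using w0[OF \<eta>] smooth_functional_linear[OF \<eta>] by (simp add: linear_add linear_scale)
        then show ?thesis using smooth_functional_le_norm[OF \<eta>] by simp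
      qed
    qed simp
    ultimately show "max (norm y) \<bar>t\<bar> \<le> norm (y + t *\<^sub>R w0)" by simp
  qed
  define U' where "U' = {u \<in> U. \<phi> u = 0}"
  define W' where "W' = {y. y - \<phi> y *\<^sub>R w0 \<in> W}"
  have W'P: "y = P y + \<phi> y *\<^sub>R w0" if "y \<in> W'" for y
  proof -
    have "P (y - \<phi> y *\<^sub>R w0) = y - \<phi> y *\<^sub>R w0" using that P_W unfolding W'_def by blast
    then show ?thesis by (simp add: linear_diff[OF P_linear] linear_scale[OF P_linear] Pw0)
  qed
  have inW': "w + t *\<^sub>R w0 \<in> W'" "P (w + t *\<^sub>R w0) = w" "\<phi> (w + t *\<^sub>R w0) = t" if "w \<in> W" for w t
    using that \<phi>W[OF that] \<phi>w0 P_W[OF that] Pw0 unfolding W'_def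
    by (simp_all add: linear_add[OF lin] linear_scale[OF lin] linear_add[OF P_linear] linear_scale[OF P_linear])
  have subU': "subspace U'"
    unfolding U'_def using subspace_U
    by (auto simp: subspace_def linear_0[OF lin] linear_add[OF lin] linear_scale[OF lin])
  have subW': "subspace W'"
    unfolding subspace_def
  proof (intro conjI ballI allI)
    show "0 \<in> W'" unfolding W'_def using subspace_0[OF subspace_W] by (simp add: linear_0[OF lin])
    fix a b c assume a: "a \<in> W'"
    then show "c *\<^sub>R a \<in> W'" unfolding W'_def
      using subspace_scale[OF subspace_W, of "a - \<phi> a *\<^sub>R w0" c] 
      by (simp add: linear_scale[OF lin] algebra_simps)
    assume b: "b \<in> W'"
    then show "a + b \<in> W'" using a unfolding W'_def
      using subspace_add[OF subspace_W, of "a - \<phi> a *\<^sub>R w0" "b - \<phi> b *\<^sub>R w0"] 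
      by (simp add: linear_add[OF lin] algebra_simps)
  qed
  have "direct_sum_decomposition U' W'"
    unfolding direct_sum_decomposition_def
  proof (intro conjI subU' subW' allI)
    have "v = 0" if "v \<in> U'" "v \<in> W'" for v
      using W'P[OF that(2)] P_U[of v] that(1) unfolding U'_def by simp
    then show "U' \<inter> W' = {0}" using subspace_0[OF subU'] subspace_0[OF subW'] by blast
    fix v
    define u where "u = v - P v"
    have u: "u \<in> U" unfolding u_def by (rule P_diff)
    have "u - \<phi> u *\<^sub>R w0 \<in> U'" unfolding U'_def
      using subspace_diff[OF subspace_U u subspace_scale[OF subspace_U w0U]] \<phi>w0
      by (simp add: linear_diff[OF lin] linear_scale[OF lin])
    moreover have "P v + \<phi> u *\<^sub>R w0 \<in> W'" by (rule inW'(1)[OF P_in])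
    moreover have "v = (u - \<phi> u *\<^sub>R w0) + (P v + \<phi> u *\<^sub>R w0)" unfolding u_def by simp
    ultimately show "\<exists>u\<in>U'. \<exists>w\<in>W'. v = u + w" by blast
  qed
  moreover have "norm (u + y) = max (norm u) (norm y)" if "u \<in> U'" "y \<in> W'" for u y
  proof -
    have u: "u \<in> U" "\<phi> u = 0" using that(1) unfolding U'_def by auto
    have \<phi>P: "\<phi> (P y) = 0" by (rule \<phi>W[OF P_in])
    have Puy: "P (u + P y) = P y" using P_U[OF u(1)] P_W[OF P_in, of y] by (simp add: linear_add[OF P_linear])
    have "norm (u + P y + \<phi> y *\<^sub>R w0) = max (norm (u + P y)) \<bar>\<phi> y\<bar>"
      by (rule key) (simp add: linear_add[OF lin] u(2) \<phi>P)
    also have "norm (u + P y) = max (norm u) (norm (P y))"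
      using norm_eq[of "u + P y"] unfolding Puy by simp
    also have "max (max (norm u) (norm (P y))) \<bar>\<phi> y\<bar> = max (norm u) (max (norm (P y)) \<bar>\<phi> y\<bar>)"
      by (simp add: max.assoc)
    also have "max (norm (P y)) \<bar>\<phi> y\<bar> = norm y" using key[OF \<phi>P, of "\<phi> y"] W'P[OF that(2)] by simp
    finally show ?thesis using W'P[OF that(2)] by (simp add: add.assoc)
  qed
  moreover have "isometric_to_linf W' (Suc d)"
  proof -
    obtain \<Phi> where \<Phi>: "bij_betw \<Phi> W (linf_space d)"
      "\<And>v w. v \<in> W \<Longrightarrow> w \<in> W \<Longrightarrow> linf_norm d (\<lambda>i. \<Phi> v i - \<Phi> w i) = norm (v - w)"
      using iso unfolding isometric_to_linf_def by blast
    have \<Phi>in: "\<Phi> w \<in> linf_space d" if "w \<in> W" for w using \<Phi>(1) that unfolding bij_betw_def by blast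
    define \<Psi> where "\<Psi> = (\<lambda>y. (\<Phi> (P y))(d := \<phi> y))"
    have "bij_betw \<Psi> W' (linf_space (Suc d))"
      unfolding bij_betw_def
    proof (intro conjI inj_onI subset_antisym subsetI)
      fix y z assume y: "y \<in> W'" and z: "z \<in> W'" and eq: "\<Psi> y = \<Psi> z"
      have "\<phi> y = \<phi> z" using fun_cong[OF eq, of d] unfolding \<Psi>_def by simp
      moreover have "\<Phi> (P y) = \<Phi> (P z)"
      proof
        fix i show "\<Phi> (P y) i = \<Phi> (P z) i"
          using fun_cong[OF eq, of i] \<Phi>in[OF P_in, of y] \<Phi>in[OF P_in, of z]
          unfolding \<Psi>_def linf_space_def by (cases "i = d") auto
      qed
      then have "P y = P z" using \<Phi>(1) P_in unfolding bij_betw_def by (metis inj_onD)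
      ultimately show "y = z" using W'P[OF y] W'P[OF z] by simp
    next
      fix a assume "a \<in> \<Psi> ` W'"
      then show "a \<in> linf_space (Suc d)" using \<Phi>in[OF P_in] unfolding \<Psi>_def linf_space_def by auto
    next
      fix a assume a: "a \<in> linf_space (Suc d)"
      have "a(d := 0) \<in> linf_space d" using a unfolding linf_space_def by auto
      then obtain w where w: "w \<in> W" "\<Phi> w = a(d := 0)"
        using \<Phi>(1) unfolding bij_betw_def by (metis imageE)
      have "\<Psi> (w + a d *\<^sub>R w0) = a" unfolding \<Psi>_def using inW'[OF w(1)] w(2) by simp
      then show "a \<in> \<Psi> ` W'" using inW'(1)[OF w(1)] by (metis image_eqI)
    qed
    moreover have "linf_norm (Suc d) (\<lambda>i. \<Psi> y i - \<Psi> z i) = norm (y - z)" if "y \<in> W'" "z \<in> W'" for y z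
    proof -
      have "linf_norm (Suc d) (\<lambda>i. \<Psi> y i - \<Psi> z i) 
        = max (linf_norm d (\<lambda>i. \<Psi> y i - \<Psi> z i)) \<bar>\<phi> y - \<phi> z\<bar>"
        unfolding linf_norm_Suc unfolding \<Psi>_def by simp
      also have "linf_norm d (\<lambda>i. \<Psi> y i - \<Psi> z i) = linf_norm d (\<lambda>i. \<Phi> (P y) i - \<Phi> (P z) i)"
        by (rule linf_norm_cong) (simp add: \<Psi>_def)
      also have "\<dots> = norm (P y - P z)" by (rule \<Phi>(2)[OF P_in P_in])
      also have "max (norm (P y - P z)) \<bar>\<phi> y - \<phi> z\<bar> = norm (P y - P z + (\<phi> y - \<phi> z) *\<^sub>R w0)"
        by (rule key[symmetric]) (simp add: linear_diff[OF lin] \<phi>W[OF P_in])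
      also have "P y - P z + (\<phi> y - \<phi> z) *\<^sub>R w0 = (P y + \<phi> y *\<^sub>R w0) - (P z + \<phi> z *\<^sub>R w0)"
        by (simp add: algebra_simps)
      also have "\<dots> = y - z" using W'P that by simp
      finally show ?thesis .
    qed
    ultimately show ?thesis unfolding isometric_to_linf_def by blast
  qed
  ultimately have "linf_splitting U' W' (Suc d)" unfolding linf_splitting_def by blast
  moreover have "W \<subset> W'"
  proof
    show "W \<subseteq> W'" unfolding W'_def using \<phi>W by auto
    have "w0 \<in> W'" using inW'(1)[OF subspace_0[OF subspace_W], of 1] by simp
    moreover have "w0 \<notin> W" using \<phi>W \<phi>w0 by force
    ultimately show "W \<noteq> W'" by blast
  qed
  ultimately show ?thesis by blast
qed

end

section \<open>The decomposition in terms of smooth functionals\<close>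

lemma free_functional_uminus:
  assumes "free_functional \<phi>"
  shows "free_functional (\<lambda>x. - \<phi> x)"
  using assms smooth_functional_uminus unfolding free_functional_def by auto

lemma smooth_functional_compose:
  fixes T :: "'v::real_normed_vector \<Rightarrow> 'v"
  assumes T: "linear T" "bij T" "\<And>x. norm (T x) = norm x" and \<phi>: "smooth_functional \<phi>"
  shows "smooth_functional (\<phi> \<circ> T)"
proof -
  obtain v where v: "norm_gradient v \<phi>" using \<phi> unfolding smooth_functional_def by blast
  obtain u where u: "v = T u" using T(2) by (metis bij_pointE)
  have "norm (real n *\<^sub>R u + y) = norm (real n *\<^sub>R v + T y)" for n y
    unfolding u T(3)[of "real n *\<^sub>R u + y", symmetric] by (simp add: linear_add[OF T(1)] linear_scale[OF T(1)])
  then have "norm_gradient u (\<phi> \<circ> T)"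
    using norm_gradientD[OF v] T(3)[of u] linear_compose[OF T(1)] u unfolding norm_gradient_def by simp
  then show ?thesis unfolding smooth_functional_def by blast
qed

lemma linear_isometry_inv:
  fixes T :: "'v::real_normed_vector \<Rightarrow> 'v"
  assumes T: "linear T" "bij T" "\<And>x. norm (T x) = norm x"
  shows "linear (inv T)" "bij (inv T)" "norm (inv T x) = norm x"
proof -
  have TS: "T (inv T x) = x" for x using T(2) by (simp add: bij_is_surj surj_f_inv_f)
  have ST: "inv T (T x) = x" for x using T(2) by (simp add: bij_is_inj)
  show "linear (inv T)"
  proof (rule linearI)
    fix a b c
    have "T (inv T a + inv T b) = a + b" by (simp add: linear_add[OF T(1)] TS)
    then show "inv T (a + b) = inv T a + inv T b" using ST by metis
    have "T (c *\<^sub>R inv T a) = c *\<^sub>R a" by (simp add: linear_scale[OF T(1)] TS)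
    then show "inv T (c *\<^sub>R a) = c *\<^sub>R inv T a" using ST by metis
  qed
  show "bij (inv T)" using T(2) by (rule bij_imp_bij_inv)
  show "norm (inv T x) = norm x" using T(3)[of "inv T x"] TS by simp
qed

lemma free_functional_compose:
  fixes T :: "'v::real_normed_vector \<Rightarrow> 'v"
  assumes T: "linear T" "bij T" "\<And>x. norm (T x) = norm x" and \<phi>: "free_functional \<phi>"
  shows "free_functional (\<phi> \<circ> T)"
proof -
  note S = linear_isometry_inv[OF T]
  have TS: "T (inv T x) = x" for x using T(2) by (simp add: bij_is_surj surj_f_inv_f)
  have ST: "inv T (T x) = x" for x using T(2) by (simp add: bij_is_inj)
  obtain w where w: "\<phi> w \<noteq> 0"
    "\<And>\<eta>. smooth_functional \<eta> \<Longrightarrow> \<eta> \<noteq> \<phi> \<Longrightarrow> \<eta> \<noteq> (\<lambda>x. - \<phi> x) \<Longrightarrow> \<eta> w = 0"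
    and sm: "smooth_functional \<phi>"
    using \<phi> unfolding free_functional_def by blast
  have "\<eta> (inv T w) = 0"
    if \<eta>: "smooth_functional \<eta>" "\<eta> \<noteq> \<phi> \<circ> T" "\<eta> \<noteq> (\<lambda>x. - (\<phi> \<circ> T) x)" for \<eta>
  proof -
    have "(\<eta> \<circ> inv T) w = 0"
    proof (rule w(2))
      show "smooth_functional (\<eta> \<circ> inv T)" by (rule smooth_functional_compose[OF S \<eta>(1)])
      show "\<eta> \<circ> inv T \<noteq> \<phi>"
      proof
        assume *: "\<eta> \<circ> inv T = \<phi>"
        have "\<eta> x = (\<phi> \<circ> T) x" for x using fun_cong[OF *, of "T x"] ST by simp
        then show False using \<eta>(2) by blast
      qed
      show "\<eta> \<circ> inv T \<noteq> (\<lambda>x. - \<phi> x)"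
      proof
        assume *: "\<eta> \<circ> inv T = (\<lambda>x. - \<phi> x)"
        have "\<eta> x = - (\<phi> \<circ> T) x" for x using fun_cong[OF *, of "T x"] ST by simp
        then show False using \<eta>(3) by blast
      qed
    qed
    then show ?thesis by simp
  qed
  moreover have "(\<phi> \<circ> T) (inv T w) \<noteq> 0" using w(1) TS by simp
  ultimately show ?thesis
    unfolding free_functional_def using smooth_functional_compose[OF T sm] by blast
qed

lemma free_functional_compose_iff:
  fixes T :: "'v::real_normed_vector \<Rightarrow> 'v"
  assumes T: "linear T" "bij T" "\<And>x. norm (T x) = norm x"
  shows "free_functional (\<phi> \<circ> T) \<longleftrightarrow> free_functional \<phi>"
proof
  assume "free_functional (\<phi> \<circ> T)"
  then have "free_functional ((\<phi> \<circ> T) \<circ> inv T)"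
    by (rule free_functional_compose[OF linear_isometry_inv[OF T]])
  moreover have "(\<phi> \<circ> T) \<circ> inv T = \<phi>" using T(2) by (simp add: fun_eq_iff bij_is_surj surj_f_inv_f)
  ultimately show "free_functional \<phi>" by simp
qed (rule free_functional_compose[OF T])

text \<open>This is the form in which maximality of the \<open>\<ell>\<^sub>\<infinity>\<close>-part is used.\<close>

locale maximal_linf_coordinates = linf_coordinates U W d P x e
  for U W :: "'v::real_normed_vector set" and d P x e +
  assumes fd: "finite_dimensional TYPE('v)"
    and free_cases: "free_functional \<phi> \<Longrightarrow> \<exists>i<d. \<phi> = x i \<or> \<phi> = (\<lambda>v. - x i v)"

lemma linf_decomposition_coordinates:
  fixes U W :: "'v::real_normed_vector set"
  assumes fd: "finite_dimensional TYPE('v)" and dec: "linf_decomposition U W d"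
  obtains P x e where "maximal_linf_coordinates U W d P x e"
proof -
  have sp: "linf_splitting U W d"
    and max: "\<And>U' W' d'. linf_splitting U' W' d' \<Longrightarrow> W \<subseteq> W' \<Longrightarrow> W' = W"
    using dec unfolding linf_decomposition_def by blast+
  obtain P x e where "linf_coordinates U W d P x e" using linf_splitting_coordinates[OF sp] by blast
  then interpret linf_coordinates U W d P x e .
  have iso: "isometric_to_linf W d" using sp unfolding linf_splitting_def by blast
  have "\<exists>i<d. \<phi> = x i \<or> \<phi> = (\<lambda>v. - x i v)" if free: "free_functional \<phi>" for \<phi>
  proof (rule ccontr)
    assume "\<not> ?thesis"
    then have "\<phi> \<noteq> x i \<and> \<phi> \<noteq> (\<lambda>v. - x i v)" if "i < d" for i using that by blast
    then obtain U' W' where "linf_splitting U' W' (Suc d)" "W \<subset> W'"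
      using linf_splitting_extend[OF fd iso free] by blast
    then show False using max by blast
  qed
  then have "maximal_linf_coordinates U W d P x e" by unfold_locales (use fd in auto)
  then show thesis by (rule that)
qed

context maximal_linf_coordinates
begin

lemma U_iff: "v \<in> U \<longleftrightarrow> (\<forall>\<phi>. free_functional \<phi> \<longrightarrow> \<phi> v = 0)"
proof
  assume "v \<in> U"
  then show "\<forall>\<phi>. free_functional \<phi> \<longrightarrow> \<phi> v = 0" using free_cases x_U by fastforce
next
  assume "\<forall>\<phi>. free_functional \<phi> \<longrightarrow> \<phi> v = 0"
  then show "v \<in> U" using free_coordinate by (intro in_U_if P_eq_0) blast
qed

lemma W_iff: "v \<in> W \<longleftrightarrow> (\<forall>\<phi>. smooth_functional \<phi> \<longrightarrow> \<not> free_functional \<phi> \<longrightarrow> \<phi> v = 0)"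
proof -
  have vanish: "\<phi> w = 0" if "smooth_functional \<phi>" "\<not> free_functional \<phi>" "w \<in> W" for \<phi> w
    using smooth_functional_cases[OF that(1)] free_coordinate free_functional_uminus that(2,3) by blast
  have "v \<in> W" if v: "\<And>\<phi>. smooth_functional \<phi> \<Longrightarrow> \<not> free_functional \<phi> \<Longrightarrow> \<phi> v = 0"
  proof (rule in_W_if, rule eq_0_if_smooth_functionals_eq_0[OF fd])
    fix \<phi> :: "'v \<Rightarrow> real" assume \<phi>: "smooth_functional \<phi>"
    show "\<phi> (v - P v) = 0"
    proof (cases "free_functional \<phi>")
      case True
      then show ?thesis using P_diff[of v] U_iff by blast
    next
      case False
      then show ?thesis
        using v[OF \<phi>] vanish[OF \<phi> False P_in, of v] linear_diff[OF smooth_functional_linear[OF \<phi>]] by simp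
    qed
  qed
  then show ?thesis using vanish by blast
qed

text \<open>\<open>U\<close> and \<open>W\<close> are determined by the norm alone, through free and smooth functionals.\<close>

lemma linear_isometry_invariant:
  assumes T: "linear T" "bij T" "\<And>x. norm (T x) = norm x"
  shows "u \<in> U \<Longrightarrow> T u \<in> U" "w \<in> W \<Longrightarrow> T w \<in> W"
proof -
  show "T u \<in> U" if "u \<in> U"
    unfolding U_iff using that free_functional_compose[OF T] unfolding U_iff by fastforce
  show "T w \<in> W" if "w \<in> W"
    unfolding W_iff
  proof (intro allI impI)
    fix \<phi> :: "'v \<Rightarrow> real" assume \<phi>: "smooth_functional \<phi>" "\<not> free_functional \<phi>"
    have "(\<phi> \<circ> T) w = 0"
      using that smooth_functional_compose[OF T \<phi>(1)] \<phi>(2) free_functional_compose_iff[OF T]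
      unfolding W_iff by blast
    then show "\<phi> (T w) = 0" by simp
  qed
qed

section \<open>Coordinates without jumps and the factorisation\<close>

context
  fixes g :: "'v \<Rightarrow> 'v"
  assumes g: "step_isometry_on UNIV g" and tr: "\<And>\<phi>. smooth_functional \<phi> \<Longrightarrow> transports g \<phi> \<phi>"
begin

text \<open>The functionals that are not free see \<open>g\<close> as a translation.\<close>

lemma displacement_diff_in_W: "(g y - y) - (g y' - y') \<in> W"
  unfolding W_iff
proof (intro allI impI)
  fix \<phi> :: "'v \<Rightarrow> real" assume \<phi>: "smooth_functional \<phi>" "\<not> free_functional \<phi>"
  obtain k where "\<And>y. \<phi> (g y) = \<phi> y + k" using nonfree_functional_rigid[OF fd \<phi> tr] by blast
  then show "\<phi> ((g y - y) - (g y' - y')) = 0"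
    by (simp add: linear_diff[OF smooth_functional_linear[OF \<phi>(1)]])
qed

text \<open>A jump of the \<open>i\<close>-th coordinate at \<open>t\<close> means that \<open>G = inv g\<close> maps a whole slab into the hyperplane where the
  coordinate is \<open>t\<close>.  Take two points \<open>p\<close> and \<open>p'\<close> of the slab that differ by a small multiple of \<open>e i\<close>, and
  \<open>q = p' - e i\<close>.  Then \<open>q\<close> is at distance \<open>1\<close> from \<open>p'\<close> and less than \<open>1\<close> from \<open>p\<close>, so the
  same comparison with \<open>1\<close> holds for the preimages.  If the other coordinates avoid the jumps of \<open>G\<close>, then \<open>G p'\<close>
  and \<open>G q\<close> differ in the \<open>i\<close>-th coordinate only, and there \<open>G p'\<close> agrees with \<open>G p\<close>: a contradiction.\<close>

lemma coordinate_no_jumps: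
  assumes i: "i < d"
  shows "jump_values g (x i) = {}"
proof (rule ccontr)
  assume "jump_values g (x i) \<noteq> {}"
  then obtain t where "t \<in> jump_values g (x i)" by blast
  then obtain y y' where yt: "x i y = t" "x i y' = t" "x i (g y) < x i (g y')"
    unfolding jump_values_def by blast
  then have y: "x i y = x i y'" "x i (g y) < x i (g y')" by simp_all
  define G where "G = inv g"
  have gG: "g (G p) = p" for p
    unfolding G_def using step_isometry_on_UNIV_D(1)[OF g] by (simp add: bij_is_surj surj_f_inv_f)
  have mono: "x j v \<le> x j v'" if "j < d" "x j (g v) < x j (g v')" for j v v'
    using tr[OF smooth_coordinate[OF that(1)]] that(2) unfolding transports_def by (meson not_le)
  have mono': "x j (g v) \<le> x j (g v')" if "j < d" "x j v < x j v'" for j v v'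
    using tr[OF smooth_coordinate[OF that(1)]] that(2) unfolding transports_def by blast
  have "\<exists>s. s \<notin> jump_values G (x j)" if "j < d" for j
  proof -
    have "countable (jump_values G (x j))"
      by (rule countable_jump_values, rule mono[OF that]) (simp add: gG)
    then show ?thesis using uncountable_UNIV_real by (metis UNIV_eq_I)
  qed
  then obtain s where s: "\<And>j. j < d \<Longrightarrow> s j \<notin> jump_values G (x j)" by metis
  \<comment> \<open>A third of the gap leaves room for \<open>p\<close> and \<open>p'\<close> inside it; \<open>1 / 2\<close> keeps \<open>q\<close> within distance less than
    \<open>1\<close> of \<open>p\<close>.\<close>
  define \<delta> where "\<delta> = min ((x i (g y') - x i (g y)) / 3) (1 / 2)"
  have \<delta>: "0 < \<delta>" "\<delta> \<le> 1 / 2" "x i (g y) + 2 * \<delta> < x i (g y')"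
    unfolding \<delta>_def using y(2) by (auto simp: min_def field_simps)
  define s' where "s' = s(i := x i (g y) + \<delta>)"
  define p where "p = (\<Sum>j<d. s' j *\<^sub>R e j)"
  define p' where "p' = p + \<delta> *\<^sub>R e i"
  define q where "q = p' - e i"
  have xp: "x j p = s' j" if "j < d" for j
  proof -
    have "x j p = (\<Sum>k<d. s' k * x j (e k))"
      unfolding p_def by (simp add: linear_sum[OF x_linear[OF that]] linear_scale[OF x_linear[OF that]])
    also have "\<dots> = (\<Sum>k<d. if k = j then s' j else 0)"
      by (rule sum.cong) (use x_e that in auto)
    also have "\<dots> = s' j" using that by simp
    finally show ?thesis .
  qed
  have xp': "x j p' = s' j + (if j = i then \<delta> else 0)" if "j < d" for j
    unfolding p'_def using xp[OF that] x_e[OF i that] x_linear[OF that] by (simp add: linear_add linear_scale)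
  have xq: "x j q = x j p'" if "j < d" "j \<noteq> i" for j
    unfolding q_def using x_e[OF i that(1)] that(2) linear_diff[OF x_linear[OF that(1)]] by simp
  have squeeze: "x i (G v) = x i y" if "x i (g y) < x i v" "x i v < x i (g y')" for v
  proof (rule order_antisym)
    show "x i (G v) \<le> x i y" using mono[OF i, of "G v" y'] that(2) y(1) by (simp add: gG)
    show "x i y \<le> x i (G v)" using mono[OF i, of y "G v"] that(1) by (simp add: gG)
  qed
  have Gp: "x i (G p) = x i y" using xp[OF i] \<delta> by (intro squeeze) (simp_all add: s'_def)
  have Gp': "x i (G p') = x i y" using xp'[OF i] \<delta> by (intro squeeze) (simp_all add: s'_def)
  have e1: "norm (e i) = 1" using norm_gradientD(1)[OF norm_gradient_coordinate[OF i]] .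
  have "\<lfloor>norm (G p' - G q)\<rfloor> = \<lfloor>norm (p' - q)\<rfloor>"
    using step_isometry_on_UNIV_D(2)[OF g, of "G p'" "G q"] unfolding gG by simp
  also have "norm (p' - q) = 1" unfolding q_def using e1 by simp
  finally have far: "1 \<le> norm (G p' - G q)" by (simp add: floor_eq_iff)
  have "\<lfloor>norm (G p - G q)\<rfloor> = \<lfloor>norm (p - q)\<rfloor>"
    using step_isometry_on_UNIV_D(2)[OF g, of "G p" "G q"] unfolding gG by simp
  also have "p - q = (1 - \<delta>) *\<^sub>R e i" unfolding q_def p'_def by (simp add: algebra_simps)
  also have "\<lfloor>norm ((1 - \<delta>) *\<^sub>R e i)\<rfloor> = 0" using e1 \<delta> by (simp add: floor_eq_iff)
  finally have near: "norm (G p - G q) < 1" by (simp add: floor_eq_iff)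
  define z where "z = G p' - G q"
  have "(p' - G p') - (q - G q) \<in> W" using displacement_diff_in_W[of "G p'" "G q"] unfolding gG .
  moreover have "p' - q \<in> W" unfolding q_def using e_W[OF i] by simp
  ultimately have "(p' - q) - ((p' - G p') - (q - G q)) \<in> W" by (rule subspace_diff[OF subspace_W, rotated])
  moreover have "(p' - q) - ((p' - G p') - (q - G q)) = z" unfolding z_def by simp
  ultimately have Pz: "P z = z" using P_W by simp
  have "norm (P z) \<le> \<bar>x i z\<bar>"
  proof (rule norm_P_le)
    fix j assume j: "j < d"
    show "\<bar>x j z\<bar> \<le> \<bar>x i z\<bar>"
    proof (cases "j = i")
      case False
      have "x j (G p') = x j (G q)"
      proof (rule not_jump_value[where \<phi> = "x j" and f = G])
        show "x j p' = x j q" using xq[OF j False] by simp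
        show "x j p' \<notin> jump_values G (x j)" using xp'[OF j] s[OF j] False by (simp add: s'_def)
      qed
      then show ?thesis unfolding z_def by (simp add: linear_diff[OF x_linear[OF j]])
    qed simp
  qed simp
  also have "x i z = x i (G p - G q)" unfolding z_def using Gp Gp' by (simp add: linear_diff[OF x_linear[OF i]])
  also have "\<bar>x i (G p - G q)\<bar> \<le> norm (G p - G q)" by (rule x_le_norm[OF i])
  finally show False using far near Pz unfolding z_def by simp
qed

text \<open>The difference of both sides is in \<open>W\<close>, and its coordinates vanish because there are no jumps.\<close>

lemma translates_along_U:
  assumes u: "u \<in> U"
  shows "g (u + w) = u + g w"
proof -
  define D where "D = (g (u + w) - (u + w)) - (g w - w)"
  have "D \<in> W" unfolding D_def by (rule displacement_diff_in_W)
  moreover have "P D = 0"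
  proof (rule P_eq_0)
    fix i assume i: "i < d"
    note lin = x_linear[OF i]
    have xu: "x i (u + w) = x i w" using x_U[OF i u] by (simp add: linear_add[OF lin])
    then have "x i (g (u + w)) = x i (g w)"
      by (rule not_jump_value[where \<phi> = "x i" and f = g]) (simp add: coordinate_no_jumps[OF i])
    then show "x i D = 0" unfolding D_def using xu by (simp only: linear_diff[OF lin])
  qed
  ultimately have "D = 0" using P_W by force
  then show ?thesis unfolding D_def by (simp add: algebra_simps)
qed

lemma U_component_constant:
  assumes w: "w \<in> W"
  shows "g w - P (g w) = g 0 - P (g 0)"
proof -
  have "(g w - w) - (g 0 - 0) + w \<in> W" by (rule subspace_add[OF subspace_W displacement_diff_in_W w])
  then have "g w - g 0 \<in> W" by (simp add: algebra_simps)
  from P_W[OF this] show ?thesis by (simp add: linear_diff[OF P_linear] algebra_simps)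
qed

end

end

theorem theorem4:
  fixes f :: "'v::real_normed_vector \<Rightarrow> 'v" and U W :: "'v set" and d :: nat
  assumes "finite_dimensional TYPE('v)"
    and "linf_decomposition U W d"
    and "step_isometry_on UNIV f"
  shows "\<exists>f\<^sub>U f\<^sub>W. factorises_as f U W f\<^sub>U f\<^sub>W
           \<and> bij_betw f\<^sub>U U U \<and> distance_preserving_on U f\<^sub>U
           \<and> step_isometry_on W f\<^sub>W"
proof -
  obtain P x e where "maximal_linf_coordinates U W d P x e"
    using linf_decomposition_coordinates[OF assms(1,2)] by blast
  then interpret maximal_linf_coordinates U W d P x e .
  obtain T g where T: "linear T" "bij T" "\<And>x. norm (T x) = norm x" and f: "\<And>x. f x = T (g x)"
    and g: "step_isometry_on UNIV g" "\<And>\<phi>. smooth_functional \<phi> \<Longrightarrow> transports g \<phi> \<phi>"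
    using step_isometry_near_linear_isometry[OF assms(1,3)] by blast
  note S = linear_isometry_inv[OF T]
  note T_inv = linear_isometry_invariant[OF T] and S_inv = linear_isometry_invariant[OF S]
  have TS: "T (inv T v) = v" for v using T(2) by (simp add: bij_is_surj surj_f_inv_f)
  define c where "c = g 0 - P (g 0)"
  have c: "c \<in> U" unfolding c_def by (rule P_diff)
  have gW: "g w = c + P (g w)" if "w \<in> W" for w
    using U_component_constant[OF g that] unfolding c_def by (simp add: algebra_simps)
  define fU where "fU = (\<lambda>u. T (u + c))"
  define fW where "fW = (\<lambda>w. T (P (g w)))"
  have fU_in: "fU u \<in> U" if "u \<in> U" for u
    unfolding fU_def by (rule T_inv(1)[OF subspace_add[OF subspace_U that c]])
  have fW_in: "fW w \<in> W" for w
    unfolding fW_def by (rule T_inv(2)[OF P_in])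
  have fact: "f (u + w) = fU u + fW w" if u: "u \<in> U" and w: "w \<in> W" for u w
  proof -
    have "f (u + w) = T (u + (c + P (g w)))"
      using f[of "u + w"] translates_along_U[OF g u, of w] gW[OF w] by simp
    also have "\<dots> = fU u + fW w" unfolding fU_def fW_def by (simp add: linear_add[OF T(1)] add.assoc)
    finally show ?thesis .
  qed
  have T_dist: "norm (T a - T b) = norm (a - b)" for a b
    using T(3)[of "a - b"] by (simp add: linear_diff[OF T(1)])
  have "factorises_as f U W fU fW"
    unfolding factorises_as_def using fU_in fW_in fact by auto
  moreover have "bij_betw fU U U"
    unfolding bij_betw_def
  proof (intro conjI inj_onI subset_antisym subsetI)
    fix u u' assume "fU u = fU u'"
    then show "u = u'" unfolding fU_def using T(2) by (simp add: bij_is_inj inj_eq)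
  next
    fix u assume "u \<in> U"
    then have "inv T u - c \<in> U" by (intro subspace_diff[OF subspace_U] S_inv(1) c)
    moreover have "u = fU (inv T u - c)" unfolding fU_def by (simp add: TS)
    ultimately show "u \<in> fU ` U" by blast
  qed (use fU_in in auto)
  moreover have "distance_preserving_on U fU"
    unfolding distance_preserving_on_def fU_def dist_norm by (simp add: T_dist)
  moreover have "step_isometry_on W fW"
  proof -
    have dist: "norm (fW w - fW w') = norm (g w - g w')" if "w \<in> W" "w' \<in> W" for w w'
    proof -
      have "g w - g w' = P (g w) - P (g w')"
        by (subst gW[OF that(1)], subst gW[OF that(2)]) simp
      then show ?thesis unfolding fW_def T_dist by simp
    qed
    have "bij_betw fW W W"
      unfolding bij_betw_def
    proof (intro conjI inj_onI subset_antisym subsetI)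
      fix w w' assume w: "w \<in> W" "w' \<in> W" "fW w = fW w'"
      then have "g w = g w'" using dist[OF w(1,2)] by simp
      then show "w = w'" using step_isometry_on_UNIV_D(1)[OF g(1)] by (simp add: bij_is_inj inj_eq)
    next
      fix w assume w: "w \<in> W"
      \<comment> \<open>\<open>T c\<close> is the \<open>U\<close>-component of \<open>f\<close> on \<open>W\<close>.\<close>
      obtain v where v: "T c + w = f v"
        using step_isometry_on_UNIV_D(1)[OF assms(3)] by (metis bij_pointE)
      have "f v = fU (v - P v) + fW (P v)" using fact[OF P_diff[of v] P_in[of v]] by simp
      then have "P (T c + w) = P (fU (v - P v) + fW (P v))" using v by simp
      then have "w = fW (P v)"
        using P_U[OF T_inv(1)[OF c]] P_W[OF w] P_U[OF fU_in[OF P_diff[of v]]] P_W[OF fW_in[of "P v"]]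
        by (simp add: linear_add[OF P_linear])
      then show "w \<in> fW ` W" using P_in by blast
    qed (use fW_in in auto)
    then show ?thesis
      unfolding step_isometry_on_def using dist step_isometry_on_UNIV_D(2)[OF g(1)] by simp
  qed
  ultimately show ?thesis by blast
qed

end
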